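(* If $f\in\mathcal{S}$, then $$|T^{s}_{2,2}(f^{-1})|\le 29,\qquad |T^{s}_{2,3}(f^{-1})|\le 221,\qquad |T^{s}_{3,1}(f^{-1})|\le 24.$$ All inequalities are sharp, i.e. each bound is attained by some $f\in\mathcal{S}$.
   Context: Let $\mathbb{D}=\{z\in\mathbb{C}:|z|<1\}$. $\mathcal{A}$ is the class of functions $f$ analytic in $\mathbb{D}$ with $f(0)=0$, $f'(0)=1$, i.e. $f(z)=z+a_2z^2+a_3z^3+\cdots$; $\mathcal{S}$ is the class of functions in $\mathcal{A}$ that are univalent (injective) in $\mathbb{D}$. For $f\in\mathcal{S}$ the inverse $f^{-1}$ is defined at least on the disk $|w|<1/4$ (Koebe's 1/4 theorem) and has there an expansion $f^{-1}(w)=w+A_2w^2+A_3w^3+\cdots$ (with $A_1=1$). The symmetric Toeplitz determinant $T^{s}_{q,n}(f^{-1})$ is the determinant of the $q\times q$ matrix whose $(i,j)$ entry is $A_{n+|i-j|}$ (no complex conjugation). In particular $$T^{s}_{2,2}(f^{-1})=A_2^2-A_3^2,\quad T^{s}_{2,3}(f^{-1})=A_3^2-A_4^2,\quad T^{s}_{3,1}(f^{-1})=1-2A_2^2+2A_2^2A_3-A_3^2.$$ *)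

theory Defs
  imports "HOL-Complex_Analysis.Complex_Analysis" "Jordan_Normal_Form.Determinant"
begin

definition class_A :: "(complex \<Rightarrow> complex) set" where
  "class_A = {f. f holomorphic_on ball 0 1 \<and> f 0 = 0 \<and> deriv f 0 = 1}"

definition class_S :: "(complex \<Rightarrow> complex) set" where
  "class_S = {f \<in> class_A. inj_on f (ball 0 1)}"

text \<open>
  For \<open>f \<in> class_S\<close>, \<open>inv_into (ball 0 1) f\<close> is the compositional inverse of \<open>f\<close> on the image
  of the unit disc, an open set containing \<open>0\<close> (in fact the disc of radius \<open>1/4\<close>). Its values
  outside that image are irrelevant, as the Taylor coefficients at \<open>0\<close> only depend on the
  values near \<open>0\<close>.
\<close>

definition inverse_coeff :: "(complex \<Rightarrow> complex) \<Rightarrow> nat \<Rightarrow> complex" where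
  "inverse_coeff f k = fps_nth (fps_expansion (inv_into (ball 0 1) f) 0) k"

text \<open>
  The rows and columns are indexed from \<open>0\<close>; entries depend on \<open>\<bar>i - j\<bar>\<close> only, so this is the
  same matrix as with indices \<open>1, \<dots>, q\<close>. The names are qualified because \<open>HOL-Analysis\<close> has
  its own \<open>mat\<close> and \<open>det\<close> for matrices whose size is a type.
\<close>

definition sym_toeplitz_mat :: "nat \<Rightarrow> nat \<Rightarrow> (nat \<Rightarrow> complex) \<Rightarrow> complex Matrix.mat" where
  "sym_toeplitz_mat q n A = Matrix.mat q q (\<lambda>(i, j). A (n + nat \<bar>int i - int j\<bar>))"

definition sym_toeplitz_det :: "nat \<Rightarrow> nat \<Rightarrow> (nat \<Rightarrow> complex) \<Rightarrow> complex" where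
  "sym_toeplitz_det q n A = Determinant.det (sym_toeplitz_mat q n A)"

lemma det_mat_1_entry:
  "Determinant.det (Matrix.mat (Suc 0) (Suc 0) g) = (g (0, 0) :: complex)"
  by (subst det_single) auto

lemma det_mat_2_entries:
  "Determinant.det (Matrix.mat 2 2 g) = (g (0, 0) * g (1, 1) - g (1, 0) * g (0, 1) :: complex)"
  by (subst laplace_expansion_column[of _ 2 0])
     (auto simp: numeral_2_eq_2 cofactor_def mat_delete_def det_mat_1_entry)

lemma sym_toeplitz_det_2: "sym_toeplitz_det 2 n A = A n ^ 2 - A (n + 1) ^ 2"
  by (simp add: sym_toeplitz_det_def sym_toeplitz_mat_def det_mat_2_entries power2_eq_square)

lemma sym_toeplitz_det_3_1:
  "sym_toeplitz_det 3 1 A =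
     A 1 ^ 3 - 2 * A 1 * A 2 ^ 2 + 2 * A 2 ^ 2 * A 3 - A 1 * A 3 ^ 2"
proof -
  define g where "g = (\<lambda>(i, j). A (1 + nat \<bar>int i - int j\<bar>))"
  have minor: "mat_delete (Matrix.mat 3 3 g) i 0 =
      Matrix.mat 2 2 (\<lambda>(a, b). g (if a < i then a else Suc a, Suc b))" for i
    by (rule eq_matI) (auto simp: mat_delete_def)
  have "Determinant.det (Matrix.mat 3 3 g) =
      (\<Sum>i<3. Matrix.mat 3 3 g $$ (i, 0) * cofactor (Matrix.mat 3 3 g) i 0)"
    by (rule laplace_expansion_column) auto
  also have "\<dots> = g (0, 0) * (g (1, 1) * g (2, 2) - g (2, 1) * g (1, 2))
      - g (1, 0) * (g (0, 1) * g (2, 2) - g (2, 1) * g (0, 2))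
      + g (2, 0) * (g (0, 1) * g (1, 2) - g (1, 1) * g (0, 2))"
    unfolding cofactor_def minor det_mat_2_entries
    by (simp add: eval_nat_numeral right_diff_distrib)
  also have "\<dots> = A 1 ^ 3 - 2 * A 1 * A 2 ^ 2 + 2 * A 2 ^ 2 * A 3 - A 1 * A 3 ^ 2"
    by (simp add: g_def eval_nat_numeral algebra_simps)
  finally show ?thesis
    by (simp add: sym_toeplitz_det_def sym_toeplitz_mat_def g_def)
qed

end

theory Submission
  imports Defs
begin

text \<open>
For \<open>f z = z + a2 z\<^sup>2 + a3 z\<^sup>3 + a4 z\<^sup>4 + \<dots>\<close> in the class \<open>S\<close>, with inverse \<open>w + A2 w\<^sup>2 + A3 w\<^sup>3 + A4 w\<^sup>4 + \<dots>\<close>,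
everything follows from the four classical estimates \<open>\<bar>A2\<bar> \<le> 2\<close>, \<open>\<bar>A3\<bar> \<le> 5\<close>, \<open>\<bar>A4\<bar> \<le> 14\<close> and \<open>\<bar>a3\<bar> \<le> 3\<close> by the
triangle inequality: \<open>4 + 25 = 29\<close>, \<open>25 + 196 = 221\<close>, and, since \<open>2 A2\<^sup>2 - A3 = a3\<close>, the third determinant
is \<open>1 - 2 A2\<^sup>2 + A3 a3\<close> with \<open>1 + 8 + 15 = 24\<close>. The function \<open>z / (1 - \<i> z)\<^sup>2\<close> attains all four estimates
with arguments for which nothing cancels.

The four estimates are due to Loewner, and the proof below is his, with the differential equation
replaced by finitely many small steps. Suppose that \<open>g\<close> and \<open>G\<close> map the disc conformally onto nested
domains and that the conformal radii have ratio \<open>exp h\<close>. Then \<open>g z = G (z exp (- P z))\<close>, where \<open>P\<close> has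
nonnegative real part and \<open>P 0 = h\<close> (\<open>loewner_step\<close>). Such a \<open>P\<close> has Taylor coefficients of modulus at
most \<open>2 h\<close>, and its first two coefficients satisfy a quadratic inequality
(\<open>caratheodory_coeff_bound\<close>, \<open>caratheodory_first_second\<close>). So the coefficients of \<open>g\<close> arise from those
of \<open>G\<close> by a small explicit change.

For the inverse function this change consists of terms with positive coefficients, so the bounds \<open>2, 5, 14\<close> are
preserved up to errors of order \<open>h\<^sup>2\<close> (\<open>inverse_coeff_bounds_step\<close>). For \<open>a3\<close> the sum of the changes is
estimated by the Cauchy--Schwarz inequality (\<open>loewner_energy_step\<close>, \<open>loewner_energy_bound\<close>). A disc has
vanishing coefficients; so the estimates hold, up to an error that vanishes with the step size, for
every map that is joined to a disc by small steps (\<open>loewner_chain_bounds\<close>).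

It remains to join a dilation \<open>f (\<rho> z)\<close> of \<open>f\<close> to a disc (\<open>loewner_chain_dilation\<close>). The exterior of the
analytic Jordan domain \<open>f ` ball 0 \<rho>\<close> is the conformal image of the exterior of the disc, and its level curves
bound a family of simply connected domains between \<open>f ` ball 0 \<rho>\<close> and large, almost round discs. The
conformal radius varies continuously in this family, which supplies steps of any prescribed size.
\<close>

section \<open>Taylor coefficients of functions with nonnegative real part\<close>

lemma circle_moment_negative:
  fixes P :: "complex \<Rightarrow> complex"
  assumes P: "P holomorphic_on ball 0 1" and r: "0 < r" "r < 1"
  shows "((\<lambda>t. P (of_real r * cis (2 * pi * t)) * cis (- (2 * pi * real n * t))) has_integral
          of_real r ^ n * fps_nth (fps_expansion P 0) n) {0..1}"
proof -
  let ?c = "circlepath 0 r"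
  have "((\<lambda>u. P u / (u - 0) ^ Suc n) has_contour_integral
          ((2 * pi * \<i>) / fact n * (deriv ^^ n) P 0)) ?c"
  proof (rule Cauchy_has_contour_integral_higher_derivative_circlepath)
    show "continuous_on (cball 0 r) P"
      using P r by (auto intro!: holomorphic_on_imp_continuous_on elim!: holomorphic_on_subset)
    show "P holomorphic_on ball 0 r"
      using P r by (auto elim!: holomorphic_on_subset)
  qed (use r in auto)
  then have "((\<lambda>t. P (?c t) / (?c t - 0) ^ Suc n * vector_derivative ?c (at t)) has_integral
          ((2 * pi * \<i>) / fact n * (deriv ^^ n) P 0)) {0..1}"
    by (simp only: has_contour_integral)
  moreover have "P (?c t) / (?c t - 0) ^ Suc n * vector_derivative ?c (at t) =
      (2 * pi * \<i> / of_real r ^ n) * (P (of_real r * cis (2 * pi * t)) * cis (- (2 * pi * real n * t)))" for t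
  proof -
    have "?c t = of_real r * exp (2 * of_real pi * \<i> * of_real t)"
      by (simp add: circlepath)
    moreover have "exp (2 * of_real pi * \<i> * of_real t) = cis (2 * pi * t)"
      by (simp add: cis_conv_exp mult_ac)
    ultimately have "?c t = of_real r * cis (2 * pi * t)" "vector_derivative ?c (at t) = 2 * pi * \<i> * ?c t"
      using vector_derivative_circlepath[of 0 r t] by simp_all
    moreover have "cis (- (2 * pi * real n * t)) = 1 / cis (2 * pi * t) ^ n"
      unfolding Complex.DeMoivre by (simp add: divide_inverse mult_ac)
    ultimately show ?thesis using r by (simp add: field_simps power_mult_distrib)
  qed
  ultimately have "((\<lambda>t. (2 * pi * \<i> / of_real r ^ n) *
        (P (of_real r * cis (2 * pi * t)) * cis (- (2 * pi * real n * t)))) has_integral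
          ((2 * pi * \<i>) / fact n * (deriv ^^ n) P 0)) {0..1}"
    by simp
  from has_integral_mult_right[OF this, of "of_real r ^ n / (2 * pi * \<i>)"]
  show ?thesis using r by (simp add: fps_expansion_def field_simps)
qed

lemma circle_moment_positive:
  fixes P :: "complex \<Rightarrow> complex"
  assumes P: "P holomorphic_on ball 0 1" and r: "0 < r" "r < 1" and n: "n \<noteq> 0"
  shows "((\<lambda>t. P (of_real r * cis (2 * pi * t)) * cis (2 * pi * real n * t)) has_integral 0) {0..1}"
proof -
  let ?Q = "\<lambda>z. P z * z ^ n"
  have Q: "?Q holomorphic_on ball 0 1" using P by (auto intro!: holomorphic_intros)
  have "fps_nth (fps_expansion ?Q 0) 0 = 0" using n by (simp add: fps_expansion_def)
  with circle_moment_negative[OF Q r, of 0]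
  have "((\<lambda>t. ?Q (of_real r * cis (2 * pi * t))) has_integral 0) {0..1}" by simp
  from has_integral_mult_right[OF this, of "1 / of_real r ^ n"]
  moreover have "cis (2 * pi * real n * t) = cis (2 * pi * t) ^ n" for t
    unfolding Complex.DeMoivre by (simp add: mult_ac)
  ultimately show ?thesis using r by (simp add: power_mult_distrib mult_ac)
qed

text \<open>
Adding the conjugate of the vanishing positive moment turns \<open>P\<close> into \<open>2 Re P\<close>. So the Taylor
coefficients of \<open>P\<close> are Fourier coefficients of the nonnegative density \<open>Re P\<close>, whose total mass
is \<open>P 0\<close>; every inequality below is the positivity of the integral of \<open>Re P\<close> against a
nonnegative trigonometric polynomial.
\<close>

lemma Re_circle_moment:
  fixes P :: "complex \<Rightarrow> complex"
  assumes P: "P holomorphic_on ball 0 1" and P0: "P 0 = of_real h" and r: "0 < r" "r < 1"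
  shows "((\<lambda>t. of_real (Re (P (of_real r * cis (2 * pi * t)))) * cis (- (2 * pi * real n * t)))
          has_integral (if n = 0 then of_real h else of_real r ^ n * fps_nth (fps_expansion P 0) n / 2)) {0..1}"
proof -
  let ?p = "\<lambda>t. P (of_real r * cis (2 * pi * t))"
  have neg: "((\<lambda>t. ?p t * cis (- (2 * pi * real n * t))) has_integral
          of_real r ^ n * fps_nth (fps_expansion P 0) n) {0..1}"
    by (rule circle_moment_negative[OF P r])
  have "((\<lambda>t. ?p t * cis (2 * pi * real n * t)) has_integral (if n = 0 then of_real h else 0)) {0..1}"
    using circle_moment_positive[OF P r, of n] circle_moment_negative[OF P r, of 0] P0
    by (auto simp: fps_expansion_def)
  then have "((\<lambda>t. cnj (?p t * cis (2 * pi * real n * t))) has_integral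
      cnj (if n = 0 then of_real h else 0)) {0..1}"
    using has_integral_cnj[of "\<lambda>t. ?p t * cis (2 * pi * real n * t)"] by (simp only: o_def)
  from has_integral_divide[OF has_integral_add[OF neg this], of 2]
  have "((\<lambda>t. (?p t * cis (- (2 * pi * real n * t)) + cnj (?p t * cis (2 * pi * real n * t))) / 2)
      has_integral (of_real r ^ n * fps_nth (fps_expansion P 0) n + cnj (if n = 0 then of_real h else 0)) / 2) {0..1}"
    by simp
  moreover have "(?p t * cis (- (2 * pi * real n * t)) + cnj (?p t * cis (2 * pi * real n * t))) / 2
      = of_real (Re (?p t)) * cis (- (2 * pi * real n * t))" for t
  proof -
    let ?w = "cis (- (2 * pi * real n * t))"
    have 1: "cnj (?p t * cis (2 * pi * real n * t)) = cnj (?p t) * ?w" by (simp add: cis_cnj)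
    have 2: "?p t * ?w + cnj (?p t) * ?w = (2 * of_real (Re (?p t))) * ?w"
      by (simp only: complex_add_cnj of_real_mult of_real_numeral flip: distrib_right)
    show ?thesis unfolding 1 2 by simp
  qed
  ultimately show ?thesis using P0 by (auto simp: fps_expansion_def)
qed

text \<open>
Bounds are obtained on circles of radius \<open>r < 1\<close>, or for the dilations \<open>f (r z)\<close>; this passes to
\<open>r = 1\<close>.
\<close>

lemma le_of_scaled_le_near_1:
  fixes f :: "real \<Rightarrow> real"
  assumes "continuous_on UNIV f" and "\<And>r. 0 < r \<Longrightarrow> r < 1 \<Longrightarrow> f r \<le> b"
  shows "f 1 \<le> b"
proof -
  have "(f \<longlongrightarrow> f 1) (at_left 1)"
    using assms(1) by (meson UNIV_I continuous_on_def tendsto_within_subset subset_UNIV)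
  moreover have "\<forall>\<^sub>F r in at_left (1::real). f r \<le> b"
  proof (rule eventually_mono)
    show "\<forall>\<^sub>F r in at_left 1. r \<in> {0<..<1 :: real}" by (rule eventually_at_left_real) simp
  qed (auto intro: assms(2))
  ultimately show ?thesis by (rule tendsto_upperbound) auto
qed

text \<open>
The first bound compares a Fourier coefficient with the total mass. The second integrates
\<open>(cos \<theta> - m)\<^sup>2 \<ge> 0\<close>; it keeps \<open>P 0 = 0\<close> in the same statement, where the optimal \<open>m\<close> would be a
quotient by \<open>P 0\<close>.
\<close>

lemma
  fixes P :: "complex \<Rightarrow> complex"
  assumes P: "P holomorphic_on ball 0 1" and P0: "P 0 = of_real h"
    and pos: "\<And>z. cmod z < 1 \<Longrightarrow> 0 \<le> Re (P z)"
  shows caratheodory_coeff_bound: "n \<noteq> 0 \<Longrightarrow> cmod (fps_nth (fps_expansion P 0) n) \<le> 2 * h"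
    and caratheodory_quadratic:
      "m * Re (fps_nth (fps_expansion P 0) 1) - m\<^sup>2 * h \<le> Re (fps_nth (fps_expansion P 0) 2) / 4 + h / 2"
proof -
  let ?c = "\<lambda>n. fps_nth (fps_expansion P 0) n"
  have circle: "(n \<noteq> 0 \<longrightarrow> r ^ n * cmod (?c n) \<le> 2 * h) \<and>
     m * (r * Re (?c 1)) - r\<^sup>2 * Re (?c 2) / 4 \<le> h / 2 + m\<^sup>2 * h" if r: "0 < r" "r < 1" for r n m
  proof
    define p where "p t = Re (P (of_real r * cis (2 * pi * t)))" for t
    have p_nonneg: "0 \<le> p t" for t using r by (auto simp: p_def intro!: pos simp: norm_mult)
    note moment = Re_circle_moment[OF P P0 r, folded p_def]
    have total: "(p has_integral h) {0..1}"
      using has_integral_Re[OF moment[of 0]] by simp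
    show "n \<noteq> 0 \<longrightarrow> r ^ n * cmod (?c n) \<le> 2 * h"
    proof
      assume n: "n \<noteq> 0"
      have "cmod (integral {0..1} (\<lambda>t. of_real (p t) * cis (- (2 * pi * real n * t)))) \<le> integral {0..1} p"
        using moment[of n] total p_nonneg
        by (intro integral_norm_bound_integral) (auto simp: norm_mult intro: has_integral_integrable)
      then show "r ^ n * cmod (?c n) \<le> 2 * h"
        using integral_unique[OF moment[of n]] integral_unique[OF total] n r
        by (simp add: norm_mult norm_power norm_divide)
    qed
    have first: "((\<lambda>t. p t * cos (2 * pi * t)) has_integral r * Re (?c 1) / 2) {0..1}"
      using has_integral_Re[OF moment[of 1]] by simp
    have second: "((\<lambda>t. p t * cos (4 * pi * t)) has_integral r\<^sup>2 * Re (?c 2) / 2) {0..1}"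
      using has_integral_Re[OF moment[of 2]] by (simp flip: of_real_power)
    have "((\<lambda>t. (p t * cos (4 * pi * t) + p t) / 2 - 2 * m * (p t * cos (2 * pi * t)) + m\<^sup>2 * p t) has_integral
        (r\<^sup>2 * Re (?c 2) / 2 + h) / 2 - 2 * m * (r * Re (?c 1) / 2) + m\<^sup>2 * h) {0..1}"
      by (intro has_integral_add has_integral_diff has_integral_mult_right has_integral_divide first second total)
    then have "0 \<le> (r\<^sup>2 * Re (?c 2) / 2 + h) / 2 - 2 * m * (r * Re (?c 1) / 2) + m\<^sup>2 * h"
    proof (rule has_integral_nonneg)
      fix t :: real
      have "cos (4 * pi * t) = 2 * (cos (2 * pi * t))\<^sup>2 - 1"
        using cos_double_cos[of "2 * pi * t"] by (simp add: mult_ac)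
      then have "(p t * cos (4 * pi * t) + p t) / 2 - 2 * m * (p t * cos (2 * pi * t)) + m\<^sup>2 * p t
          = p t * (cos (2 * pi * t) - m)\<^sup>2"
        by (simp only: power2_diff) (simp add: field_simps)
      then show "0 \<le> (p t * cos (4 * pi * t) + p t) / 2 - 2 * m * (p t * cos (2 * pi * t)) + m\<^sup>2 * p t"
        using p_nonneg[of t] by simp
    qed
    then show "m * (r * Re (?c 1)) - r\<^sup>2 * Re (?c 2) / 4 \<le> h / 2 + m\<^sup>2 * h"
      by (simp add: field_simps)
  qed
  show "cmod (?c n) \<le> 2 * h" if "n \<noteq> 0"
  proof -
    have "1 ^ n * cmod (?c n) \<le> 2 * h"
      by (rule le_of_scaled_le_near_1) (use circle that in \<open>auto intro!: continuous_intros\<close>)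
    then show ?thesis by simp
  qed
  have "m * (1 * Re (?c 1)) - 1\<^sup>2 * Re (?c 2) / 4 \<le> h / 2 + m\<^sup>2 * h"
    by (rule le_of_scaled_le_near_1) (use circle in \<open>auto intro!: continuous_intros\<close>)
  then show "m * Re (?c 1) - m\<^sup>2 * h \<le> Re (?c 2) / 4 + h / 2" by simp
qed

text \<open>
For \<open>P = h (1 + \<omega> z) / (1 - \<omega> z)\<close> with \<open>\<bar>\<omega>\<bar> = 1\<close> one has \<open>k = Re \<omega>\<close> and equality holds. In this
sense \<open>k\<close> is the cosine of the driving function of Loewner's equation.
\<close>

lemma caratheodory_first_second:
  fixes P :: "complex \<Rightarrow> complex"
  assumes P: "P holomorphic_on ball 0 1" and P0: "P 0 = of_real h"
    and pos: "\<And>z. cmod z < 1 \<Longrightarrow> 0 \<le> Re (P z)"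
  obtains k where "\<bar>k\<bar> \<le> 1" "Re (fps_nth (fps_expansion P 0) 1) = 2 * h * k"
    "4 * h * k\<^sup>2 - 2 * h \<le> Re (fps_nth (fps_expansion P 0) 2)"
proof -
  define d where "d = Re (fps_nth (fps_expansion P 0) 1)"
  have h: "0 \<le> h" using pos[of 0] P0 by simp
  have bound: "\<bar>d\<bar> \<le> 2 * h"
    using abs_Re_le_cmod caratheodory_coeff_bound[OF P P0 pos, of 1] unfolding d_def
    by (smt (verit) one_neq_zero)
  have quad: "4 * (m * d - m\<^sup>2 * h) - 2 * h \<le> Re (fps_nth (fps_expansion P 0) 2)" for m
    using caratheodory_quadratic[OF P P0 pos, of m] by (simp add: d_def)
  show thesis
  proof (cases "h = 0")
    case True
    then show thesis using bound quad[of 0] by (intro that[of 0]) (auto simp: d_def)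
  next
    case False
    show thesis
    proof (rule that[of "d / (2 * h)"])
      show "\<bar>d / (2 * h)\<bar> \<le> 1" using bound h False by (simp add: abs_divide)
      show "4 * h * (d / (2 * h))\<^sup>2 - 2 * h \<le> Re (fps_nth (fps_expansion P 0) 2)"
        using quad[of "d / (2 * h)"] False by (simp add: power2_eq_square field_simps)
    qed (use False in \<open>simp add: d_def\<close>)
  qed
qed

section \<open>Taylor coefficients under subordination\<close>

lemma fps_compose_X_times_nth:
  fixes A E :: "'a::comm_ring_1 fps"
  shows "fps_nth (fps_compose A (fps_X * E)) n = (\<Sum>i=0..n. fps_nth A i * fps_nth (E ^ i) (n - i))"
proof -
  have "fps_nth ((fps_X * E) ^ i) n = fps_nth (E ^ i) (n - i)" if "i \<in> {0..n}" for i
    using that unfolding power_mult_distrib fps_X_power_mult_nth by simp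
  then show ?thesis unfolding fps_compose_nth by (intro sum.cong) auto
qed

lemma fps_compose_X_times_low_order:
  fixes A E :: "complex fps"
  defines "e \<equiv> fps_nth E" and "a \<equiv> fps_nth A" and "c \<equiv> fps_nth (fps_compose A (fps_X * E))"
  shows "c 1 = a 1 * e 0"
    and "c 2 = a 1 * e 1 + a 2 * e 0 ^ 2"
    and "c 3 = a 1 * e 2 + a 2 * (2 * e 0 * e 1) + a 3 * e 0 ^ 3"
    and "c 4 = a 1 * e 3 + a 2 * (2 * e 0 * e 2 + e 1 ^ 2) + a 3 * (3 * e 0 ^ 2 * e 1) + a 4 * e 0 ^ 4"
  unfolding e_def a_def c_def fps_compose_X_times_nth
  by (simp_all add: eval_nat_numeral fps_mult_nth algebra_simps)

text \<open>
The recursion comes from the differential equation \<open>E' = - P' E\<close> for \<open>E = exp (- P)\<close>.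
\<close>

lemma fps_exp_minus_low_order:
  fixes P :: "complex \<Rightarrow> complex"
  assumes P: "P holomorphic_on ball 0 1"
  defines "p \<equiv> fps_nth (fps_expansion P 0)" and "e \<equiv> fps_nth (fps_expansion (\<lambda>z. exp (- P z)) 0)"
  shows "e 0 = exp (- P 0)" and "e 1 = - p 1 * e 0" and "e 2 = (p 1 ^ 2 / 2 - p 2) * e 0"
    and "e 3 = (- p 3 + p 1 * p 2 - p 1 ^ 3 / 6) * e 0"
proof -
  let ?E = "\<lambda>z. exp (- P z)"
  have hol: "?E holomorphic_on ball 0 1" using P by (intro holomorphic_intros)
  have fP: "P has_fps_expansion fps_expansion P 0"
    by (rule has_fps_expansion_fps_expansion[OF _ _ P]) auto
  have fE: "?E has_fps_expansion fps_expansion ?E 0"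
    by (rule has_fps_expansion_fps_expansion[OF _ _ hol]) auto
  have "deriv ?E z = - deriv P z * ?E z" if "z \<in> ball 0 1" for z
  proof -
    have "(P has_field_derivative deriv P z) (at z)"
      using P that by (rule holomorphic_derivI[OF _ open_ball])
    then have "(?E has_field_derivative - deriv P z * ?E z) (at z)"
      by (auto intro!: derivative_eq_intros)
    then show ?thesis by (rule DERIV_imp_deriv)
  qed
  then have ev: "\<forall>\<^sub>F z in nhds 0. deriv ?E z = - deriv P z * ?E z"
    using eventually_nhds_in_open[of "ball 0 (1::real)" "0::complex"] by (auto elim!: eventually_mono)
  have "(\<lambda>z. - deriv P z * ?E z) has_fps_expansion - fps_deriv (fps_expansion P 0) * fps_expansion ?E 0"
    by (intro has_fps_expansion_mult has_fps_expansion_minus has_fps_expansion_deriv fP fE)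
  then have "deriv ?E has_fps_expansion - fps_deriv (fps_expansion P 0) * fps_expansion ?E 0"
    using ev by (subst has_fps_expansion_cong[OF _ refl]) auto
  moreover have "deriv ?E has_fps_expansion fps_deriv (fps_expansion ?E 0)"
    by (rule has_fps_expansion_deriv[OF fE])
  ultimately have ode: "fps_deriv (fps_expansion ?E 0) = - fps_deriv (fps_expansion P 0) * fps_expansion ?E 0"
    using fps_expansion_unique_complex by blast
  have rec: "of_nat (Suc n) * e (Suc n) = - (\<Sum>i=0..n. of_nat (Suc i) * p (Suc i) * e (n - i))" for n
    using arg_cong[OF ode, of "\<lambda>f. fps_nth f n"]
    by (simp add: e_def p_def fps_mult_nth sum_negf)
  show e0: "e 0 = exp (- P 0)" by (simp add: e_def fps_expansion_def)
  show e1: "e 1 = - p 1 * e 0" using rec[of 0] by simp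
  have "2 * e 2 = - (p 1 * e 1 + 2 * p 2 * e 0)"
    using rec[of 1] by (simp add: numeral_2_eq_2)
  then show e2: "e 2 = (p 1 ^ 2 / 2 - p 2) * e 0"
    unfolding e1 by (simp add: power2_eq_square field_simps) 
  have "3 * e 3 = - (p 1 * e 2 + 2 * p 2 * e 1 + 3 * p 3 * e 0)"
    using rec[of 2] by (simp add: eval_nat_numeral)
  then have "e 3 = - (p 1 * e 2 + 2 * p 2 * e 1 + 3 * p 3 * e 0) / 3" by (simp add: field_simps)
  then show "e 3 = (- p 3 + p 1 * p 2 - p 1 ^ 3 / 6) * e 0"
    unfolding e1 e2 by (simp add: power2_eq_square power3_eq_cube field_simps)
qed

text \<open>
The Taylor coefficients of \<open>g / g'(0)\<close>. With this normalization maps of different conformal radius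
can be compared, and the radius enters only through the factor \<open>exp (- h)\<close> below.
\<close>

definition ncoeff :: "(complex \<Rightarrow> complex) \<Rightarrow> nat \<Rightarrow> complex" where
  "ncoeff g n = fps_nth (fps_expansion g 0) n / fps_nth (fps_expansion g 0) 1"

text \<open>
A discrete Loewner step. For small \<open>h\<close> and \<open>P = h p\<close> the first-order terms in \<open>h\<close> give Loewner's
differential equations for the coefficients.
\<close>

lemma ncoeff_subordinate:
  fixes g G P :: "complex \<Rightarrow> complex"
  assumes G: "G holomorphic_on ball 0 1" "deriv G 0 \<noteq> 0"
    and P: "P holomorphic_on ball 0 1" "P 0 = of_real h"
    and g: "\<And>z. cmod z < 1 \<Longrightarrow> g z = G (z * exp (- P z))"
  defines "p \<equiv> fps_nth (fps_expansion P 0)" and "c \<equiv> of_real (exp (- h))"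
  shows "ncoeff g 2 = c * ncoeff G 2 - p 1"
    and "ncoeff g 3 = c ^ 2 * ncoeff G 3 - 2 * c * p 1 * ncoeff G 2 + p 1 ^ 2 / 2 - p 2"
    and "ncoeff g 4 = c ^ 3 * ncoeff G 4 - 3 * c ^ 2 * p 1 * ncoeff G 3
           + 2 * c * (p 1 ^ 2 - p 2) * ncoeff G 2 + (- p 3 + p 1 * p 2 - p 1 ^ 3 / 6)"
proof -
  let ?E = "\<lambda>z. exp (- P z)"
  define E where "E = fps_expansion ?E 0"
  have hol: "?E holomorphic_on ball 0 1" using P by (intro holomorphic_intros)
  have fE: "?E has_fps_expansion E" unfolding E_def
    by (rule has_fps_expansion_fps_expansion[OF _ _ hol]) auto
  have fG: "G has_fps_expansion fps_expansion G 0"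
    by (rule has_fps_expansion_fps_expansion[OF _ _ G(1)]) auto
  have "(\<lambda>z. z * ?E z) has_fps_expansion fps_X * E"
    by (intro has_fps_expansion_mult has_fps_expansion_fps_X fE)
  from has_fps_expansion_compose[OF fG this]
  have "(\<lambda>z. G (z * ?E z)) has_fps_expansion fps_compose (fps_expansion G 0) (fps_X * E)"
    by (simp add: o_def)
  moreover have "\<forall>\<^sub>F z in nhds 0. g z = G (z * ?E z)"
    using eventually_nhds_in_open[of "ball 0 (1::real)" "0::complex"] by (auto elim!: eventually_mono simp: g)
  ultimately have "g has_fps_expansion fps_compose (fps_expansion G 0) (fps_X * E)"
    by (subst has_fps_expansion_cong[OF _ refl]) auto
  then have expand: "fps_expansion g 0 = fps_compose (fps_expansion G 0) (fps_X * E)"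
    by (rule fps_expansion_eqI)
  note E_nth = fps_exp_minus_low_order[OF P(1), folded E_def p_def]
  have E0: "fps_nth E 0 = c" using E_nth(1) P(2) by (simp add: c_def exp_of_real flip: of_real_minus)
  have nz: "c \<noteq> 0" "fps_nth (fps_expansion G 0) 1 \<noteq> 0" using G by (auto simp: c_def fps_expansion_def)
  note E_nth' = E_nth(2-4)[unfolded E0] E0
  note low = fps_compose_X_times_low_order[of "fps_expansion G 0" E, folded expand, unfolded E_nth']
  show "ncoeff g 2 = c * ncoeff G 2 - p 1"
    "ncoeff g 3 = c ^ 2 * ncoeff G 3 - 2 * c * p 1 * ncoeff G 2 + p 1 ^ 2 / 2 - p 2"
    "ncoeff g 4 = c ^ 3 * ncoeff G 4 - 3 * c ^ 2 * p 1 * ncoeff G 3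
           + 2 * c * (p 1 ^ 2 - p 2) * ncoeff G 2 + (- p 3 + p 1 * p 2 - p 1 ^ 3 / 6)"
    unfolding ncoeff_def low using nz
    by (simp_all add: field_simps power2_eq_square power3_eq_cube power4_eq_xxxx)
qed

section \<open>Coefficient inequalities for one small step\<close>

lemma exp_minus_le_quadratic:
  fixes x :: real
  assumes "0 \<le> x" shows "exp (- x) \<le> 1 - x + x\<^sup>2 / 2"
proof -
  have "(1 + x + x\<^sup>2 / 2) * (1 - x + x\<^sup>2 / 2) = 1 + x ^ 4 / 4"
    by (simp add: field_simps power2_eq_square power4_eq_xxxx)
  moreover have "0 < 1 - x + x\<^sup>2 / 2"
    using sum_power2_gt_zero_iff[of "1 - x" 1] by (simp add: power2_eq_square algebra_simps)
  ultimately have "1 \<le> exp x * (1 - x + x\<^sup>2 / 2)"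
    using exp_lower_Taylor_quadratic[OF assms] mult_right_mono[of "1 + x + x\<^sup>2 / 2" "exp x" "1 - x + x\<^sup>2 / 2"]
    by (smt (verit) zero_le_power_eq_numeral even_numeral divide_nonneg_pos)
  then show ?thesis by (simp add: exp_minus field_simps)
qed

text \<open>
The recursions on the left are those of the coefficients \<open>A2, A3, A4\<close> of the inverse function. All
their terms carry a plus sign, so taking absolute values loses nothing: to first order in \<open>h\<close> the
three inequalities read \<open>2h \<le> h \<cdot> 2\<close>, \<open>2h (2 \<cdot> 2 + 1) \<le> 2h \<cdot> 5\<close> and \<open>2h (2 \<cdot> 5 + 2\<^sup>2 + 3 \<cdot> 2 + 1) \<le> 3h \<cdot> 14\<close>,
which are equalities. The multiples of \<open>\<delta>\<close> absorb the terms of order \<open>h\<^sup>2\<close>.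
\<close>

lemma inverse_coeff_bounds_step:
  fixes p1 p2 p3 A2 A3 A4 :: complex and h \<delta> :: real
  assumes h: "0 \<le> h" "h \<le> \<delta>" and \<delta>: "\<delta> \<le> 1 / 3"
    and p: "cmod p1 \<le> 2 * h" "cmod p2 \<le> 2 * h" "cmod p3 \<le> 2 * h"
    and A: "cmod A2 \<le> 2 + 2 * \<delta>" "cmod A3 \<le> 5 + 24 * \<delta>" "cmod A4 \<le> 14 + 204 * \<delta>"
  defines "c \<equiv> of_real (exp (- h)) :: complex"
  shows "cmod (c * A2 + p1) \<le> 2 + 2 * \<delta>"
    and "cmod (c ^ 2 * A3 + 2 * c * p1 * A2 + (p2 + 3 / 2 * p1 ^ 2)) \<le> 5 + 24 * \<delta>"
    and "cmod (c ^ 3 * A4 + c ^ 2 * p1 * (2 * A3 + A2 ^ 2) + 3 * c * (p2 + 3 / 2 * p1 ^ 2) * A2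
           + (p3 + 4 * p1 * p2 + 8 / 3 * p1 ^ 3)) \<le> 14 + 204 * \<delta>"
proof -
  define C where "C = exp (- h)"
  have C: "0 < C" "C \<le> 1" using h by (auto simp: C_def)
  have nc: "cmod c = C" by (simp add: c_def C_def)
  have C1: "C \<le> 1 - h + h\<^sup>2 / 2" using exp_minus_le_quadratic[of h] h by (simp add: C_def)
  have C2: "C\<^sup>2 \<le> 1 - 2 * h + 2 * h\<^sup>2"
    using exp_minus_le_quadratic[of "2 * h"] h by (simp add: C_def power_mult_distrib flip: exp_of_nat_mult)
  have C3: "C ^ 3 \<le> 1 - 3 * h + 9 / 2 * h\<^sup>2"
    using exp_minus_le_quadratic[of "3 * h"] h by (simp add: C_def power_mult_distrib flip: exp_of_nat_mult)
  have \<delta>0: "0 \<le> \<delta>" using h by simp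
  have hh: "h\<^sup>2 \<le> h * \<delta>" using h by (simp add: power2_eq_square mult_left_mono)
  have h\<delta>: "h * \<delta> \<le> \<delta> / 3" using mult_right_mono[of h "1/3" \<delta>] h \<delta> by simp
  have \<delta>\<delta>: "\<delta>\<^sup>2 \<le> \<delta> / 3" using mult_right_mono[of \<delta> "1/3" \<delta>] h \<delta> by (simp add: power2_eq_square)
  have prod: "cmod (u * v) \<le> a * b" if "cmod u \<le> a" "cmod v \<le> b" for u v a b
    using that by (simp add: norm_mult mult_mono' )
  have add: "cmod (u + v) \<le> a + b" if "cmod u \<le> a" "cmod v \<le> b" for u v a b
    using that by (rule norm_triangle_mono)
  have pow: "cmod (u ^ n) \<le> a ^ n" if "cmod u \<le> a" for u a n
    using that by (simp add: norm_power power_mono)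
  have num: "cmod (numeral k) \<le> numeral k" for k by simp
  have ncle: "cmod c \<le> C" "cmod c \<le> 1" using nc C by auto
  have c1: "cmod (c * z) \<le> a" if "cmod z \<le> a" for z a
    using prod[OF ncle(2) that] by simp
  have c2: "cmod (c\<^sup>2 * z) \<le> a" if "cmod z \<le> a" for z a
    using prod[OF pow[OF ncle(2), of 2] that] by simp
  have q3: "cmod (p2 + 3 / 2 * p1 ^ 2) \<le> 2 * h + 3 / 2 * (2 * h) ^ 2"
    by (intro add prod pow p) simp
  have q4: "cmod (p3 + 4 * p1 * p2 + 8 / 3 * p1 ^ 3) \<le> 2 * h + 4 * (2 * h) * (2 * h) + 8 / 3 * (2 * h) ^ 3"
    by (intro add prod pow p) simp_all
  have "cmod (c * A2 + p1) \<le> C * (2 + 2 * \<delta>) + 2 * h"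
    by (intro add prod ncle A p)
  also have "\<dots> \<le> (1 - h + h\<^sup>2 / 2) * (2 + 2 * \<delta>) + 2 * h"
    using mult_right_mono[OF C1] \<delta>0 by simp
  also have "\<dots> \<le> 2 + 2 * \<delta>"
  proof -
    have "h\<^sup>2 * \<delta> \<le> h * \<delta>" using h \<delta> \<delta>0 by (simp add: power2_eq_square mult_left_le_one_le mult_right_mono)
    then show ?thesis using hh by (simp add: algebra_simps)
  qed
  finally show "cmod (c * A2 + p1) \<le> 2 + 2 * \<delta>" .
  have "cmod (c ^ 2 * A3 + 2 * (c * (p1 * A2)) + (p2 + 3 / 2 * p1 ^ 2)) \<le>
      C ^ 2 * (5 + 24 * \<delta>) + 2 * ((2 * h) * (2 + 2 * \<delta>)) + (2 * h + 3 / 2 * (2 * h) ^ 2)"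
    by (intro add q3 prod num c1 pow ncle A p)
  also have "\<dots> \<le> (1 - 2 * h + 2 * h\<^sup>2) * (5 + 24 * \<delta>) + 2 * ((2 * h) * (2 + 2 * \<delta>)) + (2 * h + 3 / 2 * (2 * h) ^ 2)"
    using mult_right_mono[OF C2] \<delta>0 by simp
  also have "\<dots> = 5 + 24 * \<delta> - h * (40 * \<delta> - 16 * h - 48 * (h * \<delta>))"
    by (simp add: algebra_simps power2_eq_square)
  also have "\<dots> \<le> 5 + 24 * \<delta>"
    using mult_nonneg_nonneg[of h "40 * \<delta> - 16 * h - 48 * (h * \<delta>)"] h h\<delta> \<delta>0 by simp
  finally show "cmod (c ^ 2 * A3 + 2 * c * p1 * A2 + (p2 + 3 / 2 * p1 ^ 2)) \<le> 5 + 24 * \<delta>"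
    by (simp add: mult.assoc)
  have "cmod (c ^ 3 * A4 + c ^ 2 * (p1 * (2 * A3 + A2 ^ 2)) + 3 * (c * ((p2 + 3 / 2 * p1 ^ 2) * A2))
           + (p3 + 4 * p1 * p2 + 8 / 3 * p1 ^ 3)) \<le>
      C ^ 3 * (14 + 204 * \<delta>) + (2 * h) * (2 * (5 + 24 * \<delta>) + (2 + 2 * \<delta>)\<^sup>2)
      + 3 * ((2 * h + 3 / 2 * (2 * h) ^ 2) * (2 + 2 * \<delta>))
      + (2 * h + 4 * (2 * h) * (2 * h) + 8 / 3 * (2 * h) ^ 3)"
    by (intro add q4 q3 c2 c1 prod[OF pow[OF ncle(1)]] prod[OF num] prod[OF q3] prod[OF p(1)] pow A)
  also have "\<dots> \<le> (1 - 3 * h + 9 / 2 * h\<^sup>2) * (14 + 204 * \<delta>) + (2 * h) * (2 * (5 + 24 * \<delta>) + (2 + 2 * \<delta>)\<^sup>2)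
      + 3 * ((2 * h + 3 / 2 * (2 * h) ^ 2) * (2 + 2 * \<delta>))
      + (2 * h + 4 * (2 * h) * (2 * h) + 8 / 3 * (2 * h) ^ 3)"
    using mult_right_mono[OF C3] \<delta>0 by simp
  also have "\<dots> = 14 + 204 * \<delta> - h * (488 * \<delta> - 115 * h - 954 * (h * \<delta>) - 8 * \<delta>\<^sup>2 - 64 / 3 * h\<^sup>2)"
    by (simp add: algebra_simps power2_eq_square power3_eq_cube)
  also have "\<dots> \<le> 14 + 204 * \<delta>"
    using mult_nonneg_nonneg[of h "488 * \<delta> - 115 * h - 954 * (h * \<delta>) - 8 * \<delta>\<^sup>2 - 64 / 3 * h\<^sup>2"]
      h h\<delta> hh \<delta>\<delta> \<delta>0 by simp
  finally show "cmod (c ^ 3 * A4 + c ^ 2 * p1 * (2 * A3 + A2 ^ 2) + 3 * c * (p2 + 3 / 2 * p1 ^ 2) * A2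
           + (p3 + 4 * p1 * p2 + 8 / 3 * p1 ^ 3)) \<le> 14 + 204 * \<delta>"
    by (simp add: mult.assoc)
qed

text \<open>
Bookkeeping for the third coefficient. For a chain with steps \<open>h\<close> taken at times \<open>t\<close> and cosines \<open>k\<close>,
the witnesses are
\<open>W = \<Sum> h exp (- t)\<close>, \<open>U = \<Sum> h exp (- t) k\<^sup>2\<close>, \<open>Y = \<Sum> h exp (- 2 t)\<close>, \<open>V = \<Sum> h exp (- 2 t) k\<^sup>2\<close>
and \<open>E = exp (- T)\<close> for the total time \<open>T\<close>, while \<open>x\<close> stands for the real part of the second
coefficient \<open>a2\<close> and \<open>b\<close> for that of \<open>a3 - a2\<^sup>2\<close>. Then \<open>x = - 2 \<Sum> h exp (- t) k\<close>, so that
\<open>x\<^sup>2 \<le> 4 W U\<close> is the Cauchy--Schwarz inequality, and \<open>b \<le> 2 Y - 4 V\<close> up to terms of order \<open>h\<^sup>2\<close>. The inequality in \<open>\<alpha>\<close> and \<open>\<beta>\<close> holds because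
\<open>k\<^sup>2 \<le> 1\<close> and \<open>\<alpha> exp (- t) \<ge> \<beta> exp (- 2 t)\<close>; it is needed for a range of \<open>\<alpha>, \<beta>\<close>, since one more step
replaces them by \<open>\<alpha> exp (- h)\<close> and \<open>\<beta> exp (- 2 h)\<close>. The last line compares the sums with
\<open>\<integral> exp (- t)\<close> and \<open>\<integral> exp (- 2 t)\<close> over \<open>[0, T]\<close>.
\<close>

definition loewner_energy :: "real \<Rightarrow> real \<Rightarrow> real \<Rightarrow> bool" where
  "loewner_energy \<delta> x b \<longleftrightarrow> (\<exists>U V W Y E.
     0 \<le> U \<and> x\<^sup>2 \<le> 4 * W * U \<and> b \<le> 2 * (1 + \<delta>) * Y - 4 * V \<and>
     (\<forall>\<alpha> \<beta>. 0 \<le> \<beta> \<longrightarrow> \<beta> \<le> \<alpha> \<longrightarrow> \<alpha> * U - \<beta> * V \<le> \<alpha> * W - \<beta> * Y) \<and>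
     0 \<le> Y \<and> Y \<le> W \<and> W \<le> exp \<delta> * (1 - E) \<and> (1 - E\<^sup>2) / 2 \<le> Y \<and> 0 < E \<and> E \<le> 1)"

lemma loewner_energy_zero: "loewner_energy \<delta> 0 0"
  unfolding loewner_energy_def by (rule exI[of _ 0], rule exI[of _ 0], rule exI[of _ 0], rule exI[of _ 0], rule exI[of _ 1]) simp

lemma loewner_energy_step:
  assumes "loewner_energy \<delta> x b" and h: "0 \<le> h" "h \<le> \<delta>" and k: "\<bar>k\<bar> \<le> 1"
    and b': "b' \<le> 2 * (1 + \<delta>) * h - 4 * h * k\<^sup>2 + exp (- h) ^ 2 * b"
  shows "loewner_energy \<delta> (exp (- h) * x - 2 * h * k) b'"
proof -
  define c where "c = exp (- h)"
  have c: "0 < c" "c \<le> 1" using h by (auto simp: c_def)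
  obtain U V W Y E where U: "0 \<le> U" and x: "x\<^sup>2 \<le> 4 * W * U" and b: "b \<le> 2 * (1 + \<delta>) * Y - 4 * V"
    and lin: "\<And>\<alpha> \<beta>. 0 \<le> \<beta> \<Longrightarrow> \<beta> \<le> \<alpha> \<Longrightarrow> \<alpha> * U - \<beta> * V \<le> \<alpha> * W - \<beta> * Y"
    and Y: "0 \<le> Y" "Y \<le> W" "W \<le> exp \<delta> * (1 - E)" "(1 - E\<^sup>2) / 2 \<le> Y" and E: "0 < E" "E \<le> 1"
    using assms(1) unfolding loewner_energy_def by blast
  have kk: "k\<^sup>2 \<le> 1" using k by (simp add: abs_square_le_1)
  have cc: "c\<^sup>2 \<le> c" using c by (simp add: power2_eq_square mult_left_le_one_le)
  show ?thesis unfolding loewner_energy_def c_def[symmetric]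
  proof (rule exI[of _ "h * k\<^sup>2 + c * U"], rule exI[of _ "h * k\<^sup>2 + c\<^sup>2 * V"], rule exI[of _ "h + c * W"],
      rule exI[of _ "h + c\<^sup>2 * Y"], rule exI[of _ "c * E"], intro conjI allI impI)
    show "0 \<le> h * k\<^sup>2 + c * U" using h c U by simp
    have "(k * x)\<^sup>2 \<le> k\<^sup>2 * (4 * W * U)"
      using x by (simp add: power_mult_distrib mult_left_mono)
    also have "\<dots> \<le> (U + W * k\<^sup>2)\<^sup>2"
      using zero_le_power2[of "U - W * k\<^sup>2"] by (simp add: power2_eq_square algebra_simps)
    finally have "\<bar>k * x\<bar> \<le> U + W * k\<^sup>2"
      using U Y by (simp add: power2_le_iff_abs_le)
    then have "c * h * (- (k * x)) \<le> c * h * (U + W * k\<^sup>2)"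
      using c h by (intro mult_left_mono) auto
    moreover have "c\<^sup>2 * x\<^sup>2 \<le> c\<^sup>2 * (4 * W * U)" using x by (intro mult_left_mono) auto
    ultimately show "(c * x - 2 * h * k)\<^sup>2 \<le> 4 * (h + c * W) * (h * k\<^sup>2 + c * U)"
      by (simp add: power2_eq_square algebra_simps)
    have "c\<^sup>2 * b \<le> c\<^sup>2 * (2 * (1 + \<delta>) * Y - 4 * V)" using b by (intro mult_left_mono) auto
    then show "b' \<le> 2 * (1 + \<delta>) * (h + c\<^sup>2 * Y) - 4 * (h * k\<^sup>2 + c\<^sup>2 * V)"
      using b' by (simp add: c_def algebra_simps)
    show "\<alpha> * (h * k\<^sup>2 + c * U) - \<beta> * (h * k\<^sup>2 + c\<^sup>2 * V) \<le> \<alpha> * (h + c * W) - \<beta> * (h + c\<^sup>2 * Y)"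
      if "0 \<le> \<beta>" "\<beta> \<le> \<alpha>" for \<alpha> \<beta>
    proof -
      have "(\<alpha> * c) * U - (\<beta> * c\<^sup>2) * V \<le> (\<alpha> * c) * W - (\<beta> * c\<^sup>2) * Y"
        using that c cc by (intro lin mult_mono) auto
      moreover have "((\<alpha> - \<beta>) * h) * k\<^sup>2 \<le> (\<alpha> - \<beta>) * h"
        using that h kk by (intro mult_left_le) auto
      ultimately show ?thesis by (simp add: algebra_simps)
    qed
    show "0 \<le> h + c\<^sup>2 * Y" using h Y by simp
    show "h + c\<^sup>2 * Y \<le> h + c * W" using Y c cc by (intro add_left_mono mult_mono) auto
    have "h \<le> exp \<delta> * (1 - c)"
    proof -
      have "h \<le> exp h * (1 - c)"
      proof -
        have "exp h * (1 - c) = exp h - 1" by (simp add: c_def right_diff_distrib flip: exp_add)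
        then show ?thesis using exp_ge_add_one_self[of h] by linarith
      qed
      also have "\<dots> \<le> exp \<delta> * (1 - c)" using h c by (intro mult_right_mono) auto
      finally show ?thesis .
    qed
    moreover have "c * W \<le> c * (exp \<delta> * (1 - E))" using Y c by (intro mult_left_mono) auto
    ultimately show "h + c * W \<le> exp \<delta> * (1 - c * E)" by (simp add: algebra_simps)
    have "1 - c\<^sup>2 \<le> 2 * h"
      using exp_ge_add_one_self[of "- (2 * h)"] by (simp add: c_def flip: exp_of_nat_mult)
    moreover have "c\<^sup>2 * ((1 - E\<^sup>2) / 2) \<le> c\<^sup>2 * Y" using Y by (intro mult_left_mono) auto
    ultimately show "(1 - (c * E)\<^sup>2) / 2 \<le> h + c\<^sup>2 * Y"
      by (simp add: power_mult_distrib field_simps)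
    show "0 < c * E" "c * E \<le> 1" using c E by (auto simp: mult_le_one)
  qed
qed

text \<open>
This is Loewner's estimate of the third coefficient. The Cauchy--Schwarz inequality reduces it to the
sum of \<open>h (4 exp \<delta> exp (- t) - 4 exp (- 2 t)) k\<^sup>2\<close>, whose weights are nonnegative, so \<open>k\<^sup>2 = 1\<close> is the worst
case, and the value is \<open>3\<close> up to an error that vanishes with \<open>\<delta>\<close>.
\<close>

lemma loewner_energy_bound:
  assumes "loewner_energy \<delta> x b" and \<delta>: "0 \<le> \<delta>"
  shows "x\<^sup>2 + b \<le> 3 + 2 * \<delta> * exp \<delta> + 4 * (exp \<delta> ^ 2 - 1)"
proof -
  obtain U V W Y E where U: "0 \<le> U" and x: "x\<^sup>2 \<le> 4 * W * U" and b: "b \<le> 2 * (1 + \<delta>) * Y - 4 * V"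
    and lin: "\<And>\<alpha> \<beta>. 0 \<le> \<beta> \<Longrightarrow> \<beta> \<le> \<alpha> \<Longrightarrow> \<alpha> * U - \<beta> * V \<le> \<alpha> * W - \<beta> * Y"
    and Y: "0 \<le> Y" "Y \<le> W" "W \<le> exp \<delta> * (1 - E)" "(1 - E\<^sup>2) / 2 \<le> Y" and E: "0 < E" "E \<le> 1"
    using assms(1) unfolding loewner_energy_def by blast
  define q where "q = exp \<delta>"
  have q: "1 \<le> q" using \<delta> by (simp add: q_def)
  have Wq: "W \<le> q * (1 - E)" using Y by (simp add: q_def)
  also have qE: "\<dots> \<le> q" using q E by (intro mult_left_le) auto
  finally have "W \<le> q" .
  then have "4 * W * U \<le> 4 * q * U" using U by (intro mult_right_mono) auto
  moreover have "4 * q * U - 4 * V \<le> 4 * q * W - 4 * Y" using q by (intro lin) auto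
  moreover have "4 * q * W \<le> 4 * q * (q * (1 - E))" using Wq q by (intro mult_left_mono) auto
  moreover have "2 * \<delta> * Y \<le> 2 * \<delta> * q" using Y \<open>W \<le> q\<close> \<delta> by (intro mult_left_mono) auto
  moreover have "4 * q * (q * (1 - E)) = 4 * (q\<^sup>2 - 1) - 4 * ((q\<^sup>2 - 1) * E) + 4 - 4 * E"
    by (simp add: power2_eq_square algebra_simps)
  moreover have "0 \<le> (q\<^sup>2 - 1) * E" using q E by simp
  moreover have "2 * (1 + \<delta>) * Y = 2 * Y + 2 * \<delta> * Y" by (simp add: algebra_simps)
  moreover have "E\<^sup>2 \<le> 4 * E" using E by (simp add: power2_eq_square mult_right_mono)
  ultimately have "x\<^sup>2 + b \<le> 3 + 2 * \<delta> * q + 4 * (q\<^sup>2 - 1)" using x b Y(4) by argo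
  then show ?thesis by (simp add: q_def)
qed

section \<open>Conformal maps of the disc that fix the origin\<close>

definition pointed_conformal :: "(complex \<Rightarrow> complex) \<Rightarrow> bool" where
  "pointed_conformal g \<longleftrightarrow> g holomorphic_on ball 0 1 \<and> inj_on g (ball 0 1) \<and> g 0 = 0 \<and>
     (\<exists>r>0. deriv g 0 = of_real r)"

definition conformal_radius :: "(complex \<Rightarrow> complex) \<Rightarrow> real" where
  "conformal_radius g = Re (deriv g 0)"

lemma pointed_conformalD:
  assumes "pointed_conformal g"
  shows "g holomorphic_on ball 0 1" "inj_on g (ball 0 1)" "g 0 = 0"
    "0 < conformal_radius g" "deriv g 0 = of_real (conformal_radius g)" "deriv g 0 \<noteq> 0"
    "open (g ` ball 0 1)" "0 \<in> g ` ball 0 1" "(g has_field_derivative of_real (conformal_radius g)) (at 0)"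
proof -
  show g: "g holomorphic_on ball 0 1" "inj_on g (ball 0 1)" "g 0 = 0"
    "0 < conformal_radius g" and d: "deriv g 0 = of_real (conformal_radius g)"
    using assms by (auto simp: pointed_conformal_def conformal_radius_def)
  show "deriv g 0 \<noteq> 0" using g(4) d by simp
  show "open (g ` ball 0 1)" using g open_mapping_thm3 by blast
  show "0 \<in> g ` ball 0 1" using g(3) by (intro image_eqI[of _ _ 0]) simp_all
  show "(g has_field_derivative of_real (conformal_radius g)) (at 0)"
    using holomorphic_derivI[OF g(1) open_ball, of 0] d by simp
qed

lemma pointed_conformal_inverse:
  assumes "pointed_conformal g"
  obtains k where "k holomorphic_on g ` ball 0 1" "\<And>z. cmod z < 1 \<Longrightarrow> k (g z) = z"
    "\<And>w. w \<in> g ` ball 0 1 \<Longrightarrow> cmod (k w) < 1 \<and> g (k w) = w"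
    "(k has_field_derivative of_real (inverse (conformal_radius g))) (at 0)"
proof -
  note g = pointed_conformalD[OF assms]
  obtain k where k: "k holomorphic_on g ` ball 0 1"
    "\<And>z. z \<in> ball 0 1 \<Longrightarrow> deriv g z * deriv k (g z) = 1" "\<And>z. z \<in> ball 0 1 \<Longrightarrow> k (g z) = z"
    using holomorphic_has_inverse[OF g(1) open_ball g(2)] by blast
  have "deriv k 0 = of_real (inverse (conformal_radius g))"
    using k(2)[of 0] g(3-5) by (simp add: field_simps)
  then have "(k has_field_derivative of_real (inverse (conformal_radius g))) (at 0)"
    using holomorphic_derivI[OF k(1) g(7,8)] by simp
  then show thesis using k by (intro that[of k]) auto
qed

lemma subordination:
  assumes G: "pointed_conformal G" and u: "u holomorphic_on ball 0 1" "u 0 = 0"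
    and sub: "u ` ball 0 1 \<subseteq> G ` ball 0 1"
  obtains \<phi> where "\<phi> holomorphic_on ball 0 1" "\<phi> 0 = 0"
    "\<And>z. cmod z < 1 \<Longrightarrow> cmod (\<phi> z) < 1 \<and> u z = G (\<phi> z)"
    "deriv u 0 = of_real (conformal_radius G) * deriv \<phi> 0"
proof -
  note g = pointed_conformalD[OF G]
  obtain k where k: "k holomorphic_on G ` ball 0 1" "\<And>z. cmod z < 1 \<Longrightarrow> k (G z) = z"
    "\<And>w. w \<in> G ` ball 0 1 \<Longrightarrow> cmod (k w) < 1 \<and> G (k w) = w"
    using pointed_conformal_inverse[OF G] by metis
  define \<phi> where "\<phi> = k \<circ> u"
  have hol: "\<phi> holomorphic_on ball 0 1"
    unfolding \<phi>_def using u(1) k(1) sub by (rule holomorphic_on_compose_gen)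
  have 0: "\<phi> 0 = 0" using k(2)[of 0] g(3) u by (simp add: \<phi>_def)
  have in_ball: "cmod (\<phi> z) < 1 \<and> u z = G (\<phi> z)" if "cmod z < 1" for z
  proof -
    have "u z \<in> G ` ball 0 1" using sub that by auto
    from k(3)[OF this] show ?thesis by (simp add: \<phi>_def)
  qed
  have "(\<phi> has_field_derivative deriv \<phi> 0) (at 0)"
    using holomorphic_derivI[OF hol open_ball, of 0] by simp
  then have "((\<lambda>z. G (\<phi> z)) has_field_derivative of_real (conformal_radius G) * deriv \<phi> 0) (at 0)"
    using DERIV_chain2[of G _ \<phi> 0] g(9) 0 by simp
  then have "(u has_field_derivative of_real (conformal_radius G) * deriv \<phi> 0) (at 0)"
    by (rule has_field_derivative_transform_within_open[of _ _ _ "ball 0 1"]) (auto simp: in_ball)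
  then show thesis using that hol 0 in_ball DERIV_imp_deriv by metis
qed

text \<open>
Comparison of conformal radii: the Schwarz lemma for \<open>G\<inverse> \<circ> u\<close>. It makes the conformal radius
monotone in the image domain, also when \<open>u\<close> is only a limit of conformal maps.
\<close>

lemma conformal_radius_maximal:
  assumes "pointed_conformal G" "u holomorphic_on ball 0 1" "u 0 = 0" "u ` ball 0 1 \<subseteq> G ` ball 0 1"
  shows "cmod (deriv u 0) \<le> conformal_radius G"
proof -
  obtain \<phi> where \<phi>: "\<phi> holomorphic_on ball 0 1" "\<phi> 0 = 0"
    "\<And>z. cmod z < 1 \<Longrightarrow> cmod (\<phi> z) < 1 \<and> u z = G (\<phi> z)"
    "deriv u 0 = of_real (conformal_radius G) * deriv \<phi> 0"
    using subordination[OF assms] by metis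
  have "cmod (deriv \<phi> 0) \<le> 1" using Schwarz_Lemma(2)[of \<phi> 0] \<phi> by auto
  then show ?thesis using pointed_conformalD(4)[OF assms(1)] \<phi>(4)
    by (simp add: norm_mult mult_left_le)
qed

lemma pointed_conformal_scale:
  assumes "pointed_conformal f" "0 < r" "r \<le> 1"
  shows "pointed_conformal (\<lambda>z. f (of_real r * z))"
    and "conformal_radius (\<lambda>z. f (of_real r * z)) = r * conformal_radius f"
    and "(\<lambda>z. f (of_real r * z)) ` ball 0 1 = f ` ball 0 r"
proof -
  note f = pointed_conformalD[OF assms(1)]
  have in_ball: "of_real r * z \<in> ball 0 1" if "z \<in> ball 0 1" for z :: complex
    using that assms by (simp add: norm_mult) (meson mult_le_one norm_ge_zero order_le_less_trans mult_left_le_one_le less_imp_le)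
  have "((\<lambda>z. f (of_real r * z)) has_field_derivative of_real (conformal_radius f) * of_real r) (at 0)"
    by (rule DERIV_chain2[of f]) (use f(9) in \<open>auto intro!: derivative_eq_intros\<close>)
  then have d: "deriv (\<lambda>z. f (of_real r * z)) 0 = of_real (r * conformal_radius f)"
    by (simp add: DERIV_imp_deriv mult.commute)
  then show "conformal_radius (\<lambda>z. f (of_real r * z)) = r * conformal_radius f"
    by (simp add: conformal_radius_def[of "\<lambda>z. f (of_real r * z)"])
  have "f \<circ> (\<lambda>z. of_real r * z) holomorphic_on ball 0 1"
    by (rule holomorphic_on_compose_gen[OF _ f(1)]) (use in_ball in \<open>auto intro!: holomorphic_intros\<close>)
  moreover have "inj_on (\<lambda>z. f (of_real r * z)) (ball 0 1)"
    using f(2) in_ball assms(2) unfolding inj_on_def by (metis mult_cancel_left of_real_eq_0_iff less_irrefl)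
  moreover have "0 < r * conformal_radius f" using assms f by simp
  ultimately show "pointed_conformal (\<lambda>z. f (of_real r * z))"
    unfolding pointed_conformal_def using d f(3) by (auto simp: o_def simp del: of_real_mult)
  have "(*) (complex_of_real r) ` ball 0 1 = ball 0 r"
    using ball_scale[of r "0::complex" 1] assms(2) by (simp add: scaleR_conv_of_real[abs_def])
  then show "(\<lambda>z. f (of_real r * z)) ` ball 0 1 = f ` ball 0 r"
    by (metis image_image)
qed

lemma pointed_conformal_disc:
  assumes "0 < R"
  shows "pointed_conformal (\<lambda>z. of_real R * z)" "conformal_radius (\<lambda>z. of_real R * z) = R"
    "(\<lambda>z::complex. of_real R * z) ` ball 0 1 = ball 0 R"
proof -
  have "deriv (\<lambda>z. of_real R * z) (0::complex) = of_real R"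
    by (rule DERIV_imp_deriv) (auto intro!: derivative_eq_intros)
  then show "pointed_conformal (\<lambda>z. of_real R * z)" "conformal_radius (\<lambda>z. of_real R * z) = R"
    using assms by (auto simp: pointed_conformal_def conformal_radius_def inj_on_def intro!: holomorphic_intros)
  show "(\<lambda>z::complex. of_real R * z) ` ball 0 1 = ball 0 R"
    using ball_scale[of R "0::complex" 1] assms by (simp add: scaleR_conv_of_real[abs_def])
qed

lemma pointed_riemann_map:
  assumes "open S" "simply_connected S" "S \<noteq> UNIV" "0 \<in> S"
  obtains g where "pointed_conformal g" "g ` ball 0 1 = S"
proof -
  have "\<exists>f g. f holomorphic_on S \<and> g holomorphic_on ball 0 1 \<and>
      (\<forall>z\<in>S. f z \<in> ball 0 1 \<and> g (f z) = z) \<and> (\<forall>z\<in>ball 0 1. g z \<in> S \<and> f (g z) = z)"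
    using iffD1[OF Riemann_mapping_theorem, of S] assms by blast
  then obtain f g where fg: "f holomorphic_on S" "g holomorphic_on ball 0 1"
    "\<And>z. z \<in> S \<Longrightarrow> f z \<in> ball 0 1 \<and> g (f z) = z" "\<And>z. z \<in> ball 0 1 \<Longrightarrow> g z \<in> S \<and> f (g z) = z"
    by blast
  have a: "norm (f 0) < 1" using fg(3)[OF assms(4)] by simp
  obtain m m' where m: "m (f 0) = 0" "m holomorphic_on ball 0 1" "m ` ball 0 1 \<subseteq> ball 0 1"
    "m' holomorphic_on ball 0 1" "m' ` ball 0 1 \<subseteq> ball 0 1"
    "\<And>z. z \<in> ball 0 1 \<Longrightarrow> m (m' z) = z" "\<And>z. z \<in> ball 0 1 \<Longrightarrow> m' (m z) = z"
    by (rule ball_biholomorphism_exists[of "f 0"]) (use a in auto)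
  have m'0: "m' 0 = f 0" using m(7)[of "f 0"] m(1) a by simp
  define u where "u = g \<circ> m'"
  have u_hol: "u holomorphic_on ball 0 1"
    unfolding u_def using m fg by (intro holomorphic_on_compose_gen[of m' _ g "ball 0 1"]) auto
  have u_inj: "inj_on u (ball 0 1)"
  proof (rule inj_on_inverseI)
    fix z :: complex assume "z \<in> ball 0 1"
    then show "(m \<circ> f) (u z) = z" using fg(4) m(5,6) by (auto simp: u_def image_subset_iff)
  qed
  have u_img: "u ` ball 0 1 = S"
  proof
    show "u ` ball 0 1 \<subseteq> S" using fg(4) m(5) by (auto simp: u_def image_subset_iff)
    show "S \<subseteq> u ` ball 0 1"
    proof
      fix w assume "w \<in> S"
      then have "f w \<in> ball 0 1" "g (f w) = w" using fg(3) by auto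
      then have "w = u (m (f w))" "m (f w) \<in> ball 0 1" using m(3,7) by (auto simp: u_def image_subset_iff)
      then show "w \<in> u ` ball 0 1" by blast
    qed
  qed
  have u0: "u 0 = 0" using m'0 fg(3)[OF assms(4)] by (simp add: u_def)
  define d where "d = deriv u 0"
  have d: "d \<noteq> 0" unfolding d_def by (rule holomorphic_injective_imp_regular[OF u_hol open_ball u_inj]) simp
  \<comment> \<open>the rotation that makes the derivative at \<open>0\<close> positive\<close>
  define e where "e = of_real (cmod d) / d"
  have e: "cmod e = 1" "e * d = of_real (cmod d)" using d by (auto simp: e_def norm_divide)
  define v where "v z = u (e * z)" for z
  have rot: "(\<lambda>z. e * z) ` ball 0 1 = ball 0 1"
  proof
    show "(\<lambda>z. e * z) ` ball 0 1 \<subseteq> ball 0 1" using e by (auto simp: norm_mult)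
    show "ball 0 1 \<subseteq> (\<lambda>z. e * z) ` ball 0 1"
    proof
      fix w :: complex assume "w \<in> ball 0 1"
      then have "w = e * (w / e)" "w / e \<in> ball 0 1" using e by (auto simp: norm_divide)
      then show "w \<in> (\<lambda>z. e * z) ` ball 0 1" by blast
    qed
  qed
  have "(u has_field_derivative d) (at 0)" unfolding d_def by (rule holomorphic_derivI[OF u_hol]) auto
  then have "(v has_field_derivative d * e) (at 0)"
    unfolding v_def by (intro DERIV_chain2[of u d]) (auto intro!: derivative_eq_intros)
  then have "deriv v 0 = of_real (cmod d)" using e by (simp add: DERIV_imp_deriv mult.commute)
  moreover have "v holomorphic_on ball 0 1"
    using holomorphic_on_compose_gen[of "\<lambda>z. e * z" "ball 0 1" u "ball 0 1"] u_hol rot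
    by (auto simp: v_def[abs_def] o_def intro!: holomorphic_intros)
  moreover have "inj_on v (ball 0 1)"
  proof (rule inj_onI)
    fix x y assume "x \<in> ball 0 1" "y \<in> ball 0 1" "v x = v y"
    then have "e * x = e * y" using u_inj rot unfolding v_def inj_on_def by blast
    then show "x = y" using e by auto
  qed
  ultimately have "pointed_conformal v"
    unfolding pointed_conformal_def using u0 d by (auto simp: v_def intro!: exI[of _ "cmod d"])
  moreover have "v ` ball 0 1 = S" using rot u_img unfolding v_def by (metis image_image)
  ultimately show thesis by (rule that)
qed

text \<open>
Here \<open>g = G \<circ> \<phi>\<close> with \<open>\<phi> z = z E z\<close> and \<open>E\<close> free of zeros, because \<open>\<phi>\<close> is injective. The Schwarz lemma
gives \<open>\<bar>E\<bar> \<le> 1\<close>, hence \<open>P = - log E\<close> has nonnegative real part. The constant \<open>h\<close> is \<open>- log \<phi>'(0)\<close>.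
\<close>

lemma loewner_step:
  assumes g: "pointed_conformal g" and G: "pointed_conformal G" and sub: "g ` ball 0 1 \<subseteq> G ` ball 0 1"
  defines "h \<equiv> ln (conformal_radius G / conformal_radius g)"
  obtains P where "P holomorphic_on ball 0 1" "P 0 = of_real h" "0 \<le> h"
    "\<And>z. cmod z < 1 \<Longrightarrow> 0 \<le> Re (P z)" "\<And>z. cmod z < 1 \<Longrightarrow> g z = G (z * exp (- P z))"
proof -
  note g' = pointed_conformalD[OF g] and G' = pointed_conformalD[OF G]
  obtain \<phi> where \<phi>: "\<phi> holomorphic_on ball 0 1" "\<phi> 0 = 0"
    "\<And>z. cmod z < 1 \<Longrightarrow> cmod (\<phi> z) < 1 \<and> g z = G (\<phi> z)"
    "deriv g 0 = of_real (conformal_radius G) * deriv \<phi> 0"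
    using subordination[OF G g'(1,3) sub] by metis
  have d: "deriv \<phi> 0 = of_real (exp (- h))"
    using \<phi>(4) g' G' by (simp add: h_def exp_minus field_simps)
  obtain E where E: "E holomorphic_on ball 0 1" "\<And>z. cmod z < 1 \<Longrightarrow> \<phi> z = z * E z" "deriv \<phi> 0 = E 0"
    using Schwarz3[OF \<phi>(1,2)] by metis
  have nz: "E z \<noteq> 0" if "z \<in> ball 0 1" for z
  proof (cases "z = 0")
    case False
    have "g z \<noteq> g 0" using inj_onD[OF g'(2), of z 0] that False by auto
    then have "\<phi> z \<noteq> 0" using \<phi>(3)[of z] \<phi>(3)[of 0] \<phi>(2) that by auto
    then show ?thesis using E(2) that by auto
  qed (use d E in simp)
  obtain L where L: "L holomorphic_on ball 0 1" "\<And>z. z \<in> ball 0 1 \<Longrightarrow> E z = exp (L z)"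
    using contractible_imp_holomorphic_log[OF E(1) _ nz] convex_imp_contractible[OF convex_ball] by metis
  define P where "P z = of_real h + L 0 - L z" for z
  have eL0: "exp (L 0) = exp (- of_real h)" using L(2)[of 0] E(3) d by (simp add: exp_of_real flip: of_real_minus)
  have eP: "exp (- P z) = E z" if "cmod z < 1" for z
    using that eL0 L(2)[of z] by (simp add: P_def exp_diff exp_add exp_minus)
  have "0 \<le> Re (P z)" if "cmod z < 1" for z
  proof -
    have "cmod (E z) \<le> 1"
    proof (cases "z = 0")
      case True
      then show ?thesis using Schwarz_Lemma(2)[OF \<phi>(1,2), of 0] \<phi>(3) E(3) by simp
    next
      case False
      have "cmod (\<phi> z) \<le> cmod z" using Schwarz_Lemma(1)[OF \<phi>(1,2)] \<phi>(3) that by blast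
      then show ?thesis using False E(2)[OF that] by (simp add: norm_mult)
    qed
    then show ?thesis using eP[OF that] by (metis norm_exp_eq_Re exp_le_one_iff uminus_complex.sel(1) neg_le_0_iff_le)
  qed
  moreover from this[of 0] have "0 \<le> h" by (simp add: P_def)
  moreover have "P holomorphic_on ball 0 1" unfolding P_def[abs_def] using L by (intro holomorphic_intros)
  moreover have "g z = G (z * exp (- P z))" if "cmod z < 1" for z
    using \<phi>(3)[OF that] E(2)[OF that] eP[OF that] by simp
  ultimately show thesis by (intro that[of P]) (auto simp: P_def)
qed

section \<open>Loewner chains\<close>

text \<open>
A finite, discrete version of a Loewner chain: increasing simply connected domains that end with a
round disc and whose conformal radii grow by a factor of at most \<open>exp \<delta>\<close> at a time.
\<close>

inductive loewner_chain :: "real \<Rightarrow> (complex \<Rightarrow> complex) \<Rightarrow> bool" for \<delta> where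
  disc: "0 < R \<Longrightarrow> loewner_chain \<delta> (\<lambda>z. of_real R * z)"
| shrink: "loewner_chain \<delta> G \<Longrightarrow> pointed_conformal g \<Longrightarrow> g ` ball 0 1 \<subseteq> G ` ball 0 1 \<Longrightarrow>
    conformal_radius G \<le> exp \<delta> * conformal_radius g \<Longrightarrow> loewner_chain \<delta> g"

lemma loewner_chain_pointed_conformal: "loewner_chain \<delta> g \<Longrightarrow> pointed_conformal g"
  by (induction rule: loewner_chain.induct) (auto intro: pointed_conformal_disc)

lemma ncoeff_disc: "n \<noteq> 1 \<Longrightarrow> ncoeff (\<lambda>z. of_real R * z) n = 0"
proof -
  assume "n \<noteq> 1"
  have "(\<lambda>z::complex. of_real R * z) has_fps_expansion fps_const (of_real R) * fps_X"
    by (intro fps_expansion_intros)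
  then have "fps_expansion (\<lambda>z::complex. of_real R * z) 0 = fps_const (of_real R) * fps_X"
    by (rule fps_expansion_eqI)
  then show ?thesis using \<open>n \<noteq> 1\<close> by (simp add: ncoeff_def)
qed

text \<open>
The coefficients of orders two, three and four of the inverse function of the normalized map
\<open>z + a2 z\<^sup>2 + a3 z\<^sup>3 + a4 z\<^sup>4 + \<dots>\<close>.
\<close>

definition inv2 :: "(complex \<Rightarrow> complex) \<Rightarrow> complex" where "inv2 g = - ncoeff g 2"
definition inv3 :: "(complex \<Rightarrow> complex) \<Rightarrow> complex" where "inv3 g = 2 * ncoeff g 2 ^ 2 - ncoeff g 3"
definition inv4 :: "(complex \<Rightarrow> complex) \<Rightarrow> complex" where
  "inv4 g = - 5 * ncoeff g 2 ^ 3 + 5 * ncoeff g 2 * ncoeff g 3 - ncoeff g 4"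

text \<open>
Induction from the disc, where all coefficients vanish, through the steps of the chain.
\<close>

lemma loewner_chain_bounds:
  assumes "loewner_chain \<delta> g" and \<delta>: "0 \<le> \<delta>" "\<delta> \<le> 1 / 3"
  shows "cmod (inv2 g) \<le> 2 + 2 * \<delta> \<and> cmod (inv3 g) \<le> 5 + 24 * \<delta> \<and> cmod (inv4 g) \<le> 14 + 204 * \<delta> \<and>
    loewner_energy \<delta> (Re (ncoeff g 2)) (Re (ncoeff g 3 - ncoeff g 2 ^ 2))"
  using assms(1)
proof (induction rule: loewner_chain.induct)
  case (disc R)
  then show ?case using \<delta> by (simp add: inv2_def inv3_def inv4_def ncoeff_disc loewner_energy_zero)
next
  case (shrink G g)
  note G = loewner_chain_pointed_conformal[OF shrink.hyps(1)] and g = shrink.hyps(2)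
  define h where "h = ln (conformal_radius G / conformal_radius g)"
  obtain P where P: "P holomorphic_on ball 0 1" "P 0 = of_real h" and h0: "0 \<le> h"
    and P_nonneg: "\<And>z. cmod z < 1 \<Longrightarrow> 0 \<le> Re (P z)" and gG: "\<And>z. cmod z < 1 \<Longrightarrow> g z = G (z * exp (- P z))"
    using loewner_step[OF g G shrink.hyps(3)] unfolding h_def by metis
  have pos: "0 < conformal_radius G" "0 < conformal_radius g" using G g pointed_conformalD(4) by auto
  then have "h \<le> ln (exp \<delta>)"
    unfolding h_def using shrink.hyps(4) by (intro ln_mono) (auto simp: divide_le_eq mult.commute)
  then have h: "h \<le> \<delta>" by simp
  define p where "p = fps_nth (fps_expansion P 0)"
  define c where "c = (of_real (exp (- h)) :: complex)"
  note G' = pointed_conformalD[OF G]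
  note a = ncoeff_subordinate[OF G'(1,6) P gG, folded p_def c_def]
  have p: "cmod (p n) \<le> 2 * h" if "n \<noteq> 0" for n
    unfolding p_def by (rule caratheodory_coeff_bound[OF P P_nonneg that])
  have inv: "inv2 g = c * inv2 G + p 1"
    "inv3 g = c ^ 2 * inv3 G + 2 * c * p 1 * inv2 G + (p 2 + 3 / 2 * p 1 ^ 2)"
    "inv4 g = c ^ 3 * inv4 G + c ^ 2 * p 1 * (2 * inv3 G + inv2 G ^ 2)
       + 3 * c * (p 2 + 3 / 2 * p 1 ^ 2) * inv2 G + (p 3 + 4 * p 1 * p 2 + 8 / 3 * p 1 ^ 3)"
    by (simp_all add: inv2_def inv3_def inv4_def a power2_eq_square power3_eq_cube field_simps)
  have b: "ncoeff g 3 - ncoeff g 2 ^ 2 = c\<^sup>2 * (ncoeff G 3 - ncoeff G 2 ^ 2) - p 2 - p 1 ^ 2 / 2"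
    by (simp add: a power2_eq_square field_simps)
  obtain k where k: "\<bar>k\<bar> \<le> 1" "Re (p 1) = 2 * h * k" "4 * h * k\<^sup>2 - 2 * h \<le> Re (p 2)"
    using caratheodory_first_second[OF P P_nonneg] unfolding p_def by metis
  have re2: "Re (ncoeff g 2) = exp (- h) * Re (ncoeff G 2) - 2 * h * k"
    using k(2) by (simp add: a(1) c_def)
  have "cmod (p 1 ^ 2) \<le> (2 * h)\<^sup>2" using p[of 1] unfolding norm_power by (intro power_mono) auto
  then have "- Re (p 1 ^ 2 / 2) \<le> 2 * h\<^sup>2"
  proof -
    have "- Re (p 1 ^ 2) \<le> cmod (p 1 ^ 2)" using abs_Re_le_cmod[of "p 1 ^ 2"] by linarith
    moreover have "(2 * h)\<^sup>2 = 4 * h\<^sup>2" "Re (p 1 ^ 2 / 2) = Re (p 1 ^ 2) / 2" by simp_all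
    ultimately show ?thesis using \<open>cmod (p 1 ^ 2) \<le> (2 * h)\<^sup>2\<close> by linarith
  qed
  moreover have "h\<^sup>2 \<le> \<delta> * h" using h h0 by (simp add: power2_eq_square mult_right_mono)
  moreover have "Re (ncoeff g 3 - ncoeff g 2 ^ 2)
      = exp (- h) ^ 2 * Re (ncoeff G 3 - ncoeff G 2 ^ 2) - Re (p 2) - Re (p 1 ^ 2 / 2)"
  proof -
    have "Re (c\<^sup>2 * w) = exp (- h) ^ 2 * Re w" for w
      by (simp add: c_def flip: of_real_power)
    then show ?thesis unfolding b minus_complex.sel(1) by (simp only: minus_complex.sel(1))
  qed
  moreover have "2 * (1 + \<delta>) * h = 2 * h + 2 * (\<delta> * h)" by (simp add: algebra_simps)
  ultimately have "Re (ncoeff g 3 - ncoeff g 2 ^ 2)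
      \<le> 2 * (1 + \<delta>) * h - 4 * h * k\<^sup>2 + exp (- h) ^ 2 * Re (ncoeff G 3 - ncoeff G 2 ^ 2)"
    using k(3) by linarith
  then have "loewner_energy \<delta> (Re (ncoeff g 2)) (Re (ncoeff g 3 - ncoeff g 2 ^ 2))"
    unfolding re2 using shrink.IH h0 h k(1) by (intro loewner_energy_step) auto
  moreover have "cmod (inv2 g) \<le> 2 + 2 * \<delta> \<and> cmod (inv3 g) \<le> 5 + 24 * \<delta> \<and> cmod (inv4 g) \<le> 14 + 204 * \<delta>"
  proof -
    have IH: "cmod (inv2 G) \<le> 2 + 2 * \<delta>" "cmod (inv3 G) \<le> 5 + 24 * \<delta>" "cmod (inv4 G) \<le> 14 + 204 * \<delta>"
      using shrink.IH by blast+
    have "cmod (p 1) \<le> 2 * h" "cmod (p 2) \<le> 2 * h" "cmod (p 3) \<le> 2 * h" using p by simp_all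
    from inverse_coeff_bounds_step[OF h0 h \<delta>(2) this IH] show ?thesis
      unfolding inv c_def by blast
  qed
  ultimately show ?case by blast
qed

section \<open>Chains from the exterior map of an analytic domain\<close>

text \<open>
The exterior of a compact neighbourhood \<open>K\<close> of \<open>0\<close>, transported to a neighbourhood of \<open>0\<close> by
\<open>w \<mapsto> 1 / w\<close>. The point \<open>w = 0\<close> stands for infinity and has to be added by hand, because \<open>inverse 0 = 0\<close>
belongs to \<open>K\<close>.
\<close>

definition outer :: "complex set \<Rightarrow> complex set" where
  "outer K = {w. w = 0 \<or> inverse w \<notin> K}"

text \<open>
The closed set \<open>g ` cball 0 s\<close> is homeomorphic to a disc, so its complement is connected and so is the
domain. The complement of the domain is the image of a punctured disc: it is connected, and unbounded
because \<open>0\<close> is an interior point of \<open>g ` cball 0 s\<close>.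
\<close>

lemma outer_image_cball:
  assumes g: "pointed_conformal g" and s: "0 < s" "s < 1"
  shows "open (outer (g ` cball 0 s))" "simply_connected (outer (g ` cball 0 s))"
    "outer (g ` cball 0 s) \<noteq> UNIV" "bounded (outer (g ` cball 0 s))"
proof -
  define K where "K = g ` cball 0 s"
  note g' = pointed_conformalD[OF g]
  have sub: "cball 0 s \<subseteq> ball (0::complex) 1" "ball 0 s \<subseteq> ball (0::complex) 1" using s by auto
  have cont: "continuous_on (cball 0 s) g"
    using g'(1) sub by (meson holomorphic_on_imp_continuous_on holomorphic_on_subset)
  have inj: "inj_on g (cball 0 s)" using g'(2) sub by (meson inj_on_subset)
  have "compact K" unfolding K_def using cont by (rule compact_continuous_image) simp
  then obtain B where B: "0 < B" "\<And>w. w \<in> K \<Longrightarrow> cmod w \<le> B" by (metis bounded_pos compact_imp_bounded)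
  have "open (g ` ball 0 s)"
    using g'(1,2) sub by (meson holomorphic_on_subset inj_on_subset open_ball open_mapping_thm3)
  moreover have "0 \<in> g ` ball 0 s" using g'(3) s by (metis centre_in_ball image_eqI)
  ultimately obtain e where e: "0 < e" "ball 0 e \<subseteq> g ` ball 0 s" by (meson open_contains_ball)
  then have eK: "ball 0 e \<subseteq> K" by (auto simp: K_def)
  have "open (- {0} \<inter> inverse -` (- K))"
    using \<open>compact K\<close> by (intro continuous_open_preimage) (auto intro!: continuous_intros compact_imp_closed)
  moreover have "outer K = ball 0 (1 / B) \<union> (- {0} \<inter> inverse -` (- K))"
  proof -
    have "inverse w \<notin> K" if "w \<noteq> 0" "cmod w < 1 / B" for w
    proof
      assume "inverse w \<in> K"
      from B(2)[OF this] have "1 \<le> B * cmod w" using that by (simp add: norm_inverse norm_divide field_simps)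
      then show False using that B(1) by (simp add: field_simps)
    qed
    then show ?thesis using B(1) by (auto simp: outer_def)
  qed
  ultimately show op: "open (outer (g ` cball 0 s))" by (simp add: K_def[symmetric] open_Un)
  have "connected (- K)"
  proof (rule connected_complement_homeomorphic_convex_compact)
    show "K homeomorphic cball (0::complex) s"
      using homeomorphic_compact[OF _ cont refl inj] homeomorphic_sym by (auto simp: K_def)
  qed auto
  moreover have "0 \<in> K" using eK e by auto
  then have "continuous_on (- K) inverse" by (intro continuous_intros) auto
  ultimately have con: "connected (inverse ` (- K))" by (rule connected_continuous_image[rotated])
  have outer_eq: "outer K = insert 0 (inverse ` (- K))"
  proof
    show "outer K \<subseteq> insert 0 (inverse ` (- K))"
      by (auto simp: outer_def) (metis ComplI image_eqI inverse_inverse_eq)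
    show "insert 0 (inverse ` (- K)) \<subseteq> outer K" by (auto simp: outer_def)
  qed
  have "0 \<in> closure (inverse ` (- K))"
    unfolding closure_approachable
  proof (intro allI impI)
    fix d :: real assume d: "0 < d"
    define t where "t = B + 1 / d + 1"
    have t: "B < t" "1 / d < t" "0 < t" using B d by (auto simp: t_def add_pos_pos)
    have "of_real t \<notin> K" using B(2)[of "of_real t"] t by auto
    moreover have "dist (inverse (of_real t)) (0::complex) < d"
      using t d by (simp add: norm_inverse norm_divide field_simps)
    ultimately show "\<exists>y\<in>inverse ` (- K). dist y 0 < d" by blast
  qed
  then have conn: "connected (outer K)"
    unfolding outer_eq using closure_subset[of "inverse ` (- K)"]
    by (intro connected_intermediate_closure[OF con]) blast+
  have compl: "- outer K = inverse ` (g ` (cball 0 s - {0}))"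
  proof -
    have "g ` (cball 0 s - {0}) = K - {0}"
      using inj g'(3) s unfolding K_def by (subst inj_on_image_set_diff[OF inj]) auto
    moreover have "- outer K = inverse ` (K - {0})"
      by (auto simp: outer_def image_iff) (metis DiffI inverse_inverse_eq singletonD inverse_nonzero_iff_nonzero)
    ultimately show ?thesis by simp
  qed
  have "connected (cball (0::complex) s - {0})"
    using s by (intro connected_punctured_convex) (auto simp: aff_dim_cball)
  then have "connected (g ` (cball 0 s - {0}))"
    using continuous_on_subset[OF cont] by (intro connected_continuous_image) auto
  moreover have "continuous_on (g ` (cball 0 s - {0})) inverse"
  proof (intro continuous_intros ballI)
    fix w assume "w \<in> g ` (cball 0 s - {0})"
    then obtain z where z: "w = g z" "z \<in> cball 0 s" "z \<noteq> 0" by blast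
    then show "w \<noteq> 0" using inj_onD[OF inj, of z 0] g'(3) s by auto
  qed
  ultimately have con': "connected (- outer K)"
    unfolding compl by (rule connected_continuous_image[rotated])
  have unb: "\<not> bounded (- outer K)"
  proof
    assume "bounded (- outer K)"
    then obtain M where M: "0 < M" "\<And>w. w \<in> - outer K \<Longrightarrow> cmod w \<le> M" by (meson bounded_pos)
    define t where "t = min (e / 2) (1 / (2 * M))"
    have t: "0 < t" "t < e" "t < 1 / M" using e M by (auto simp: t_def min_def field_simps)
    have "of_real t \<in> K" using eK t by auto
    then have "inverse (of_real t) \<in> - outer K" using t by (auto simp: outer_def)
    from M(2)[OF this] show False using t M(1) by (simp add: norm_inverse norm_divide field_simps)
  qed
  have "- outer K \<noteq> {}" using unb by auto
  then have "components (- outer K) = {- outer K}" using con' by (simp add: components_eq_sing_iff)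
  then have "\<not> bounded C" if "C \<in> components (- outer K)" for C using that unb by simp
  then show "simply_connected (outer (g ` cball 0 s))"
    using simply_connected_eq_unbounded_complement_components[OF op] conn by (simp add: K_def)
  show "outer (g ` cball 0 s) \<noteq> UNIV" using unb by (auto simp: K_def)
  have "cmod w \<le> 1 / e" if "w \<in> outer K" for w
  proof (cases "w = 0")
    case False
    then have "inverse w \<notin> ball 0 e" using that eK by (auto simp: outer_def)
    then show ?thesis using False e by (simp add: norm_inverse norm_divide field_simps)
  qed (use e in simp)
  then show "bounded (outer (g ` cball 0 s))" unfolding K_def bounded_iff by blast
qed

lemma norm_le_near_0:
  fixes g :: "complex \<Rightarrow> complex"
  assumes "(g has_field_derivative of_real a) (at 0)" "g 0 = 0" "0 < a" "1 < q"
  obtains \<eta> where "0 < \<eta>" "\<And>z. cmod z \<le> \<eta> \<Longrightarrow> cmod (g z) \<le> q * a * cmod z"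
proof -
  have "((\<lambda>z. cmod (g z / z)) \<longlongrightarrow> cmod (of_real a)) (at 0)"
    using assms(1,2) by (intro tendsto_norm) (simp add: has_field_derivative_iff)
  then have "\<forall>\<^sub>F z in at 0. cmod (g z / z) < q * a"
    using assms by (intro order_tendstoD(2)) auto
  then obtain d where d: "0 < d" "\<And>z. z \<noteq> 0 \<Longrightarrow> cmod z < d \<Longrightarrow> cmod (g z / z) < q * a"
    by (auto simp: eventually_at)
  have "cmod (g z) \<le> q * a * cmod z" if "cmod z \<le> d / 2" for z
  proof (cases "z = 0")
    case False
    then show ?thesis using d(2)[of z] d(1) that by (simp add: norm_divide field_simps)
  qed (use assms in simp)
  then show thesis using d(1) by (intro that[of "d / 2"]) auto
qed

text \<open>
The map \<open>1 / \<psi>\<close> is the conformal map onto the exterior of the analytic domain \<open>f ` ball 0 \<rho>\<close>. The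
domains \<open>outer (\<psi> ` cball 0 s)\<close> are bounded by its level curves; they shrink to the closure of
\<open>f ` ball 0 \<rho>\<close> as \<open>s\<close> tends to \<open>1\<close> and grow to almost round large discs as \<open>s\<close> tends to \<open>0\<close>. The maps
\<open>G s\<close> are their Riemann maps.
\<close>

locale exterior_exhaustion =
  fixes f \<psi> :: "complex \<Rightarrow> complex" and \<rho> :: real and G :: "real \<Rightarrow> complex \<Rightarrow> complex"
  assumes f: "pointed_conformal f" and \<rho>: "0 < \<rho>" "\<rho> < 1"
    and \<psi>: "pointed_conformal \<psi>" and \<psi>_image: "\<psi> ` ball 0 1 = outer (f ` cball 0 \<rho>)"
    and G: "\<And>s. 0 < s \<Longrightarrow> s < 1 \<Longrightarrow> pointed_conformal (G s)"
    and G_image: "\<And>s. 0 < s \<Longrightarrow> s < 1 \<Longrightarrow> G s ` ball 0 1 = outer (\<psi> ` cball 0 s)"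
begin

abbreviation \<Omega> :: "real \<Rightarrow> complex set" where "\<Omega> s \<equiv> outer (\<psi> ` cball 0 s)"

lemma \<Omega>_antimono: "s \<le> t \<Longrightarrow> \<Omega> t \<subseteq> \<Omega> s"
  unfolding outer_def using image_mono[of "cball 0 s" "cball 0 t" \<psi>] by auto

lemma radius_antimono:
  assumes "0 < s" "s \<le> t" "t < 1" shows "conformal_radius (G t) \<le> conformal_radius (G s)"
proof -
  have "cmod (deriv (G t) 0) \<le> conformal_radius (G s)"
    using assms pointed_conformalD[OF G[of t]] \<Omega>_antimono[of s t]
    by (intro conformal_radius_maximal G) (auto simp: G_image)
  then show ?thesis using pointed_conformalD[OF G[of t]] assms by simp
qed

lemma inner_subset:
  assumes "s < 1" shows "f ` cball 0 \<rho> \<subseteq> \<Omega> s"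
proof
  fix w assume w: "w \<in> f ` cball 0 \<rho>"
  show "w \<in> \<Omega> s"
  proof (rule ccontr)
    assume "w \<notin> \<Omega> s"
    then have nz: "w \<noteq> 0" and "inverse w \<in> \<psi> ` cball 0 s" by (auto simp: outer_def)
    then have "inverse w \<in> \<psi> ` ball 0 1" using assms by auto
    then show False using nz w unfolding \<psi>_image by (auto simp: outer_def)
  qed
qed

text \<open>
The curve \<open>f ` sphere 0 r\<close> is a compact part of the exterior, hence it is covered by \<open>1 / \<psi>\<close> of
a disc of radius less than \<open>1\<close>, and \<open>\<Omega> s\<close>, being connected and containing \<open>0\<close>, cannot cross it.
\<close>

lemma \<Omega>_near_boundary:
  assumes "\<rho> < r" "r < 1"
  obtains t where "t < 1" "\<And>s. t \<le> s \<Longrightarrow> 0 < s \<Longrightarrow> s < 1 \<Longrightarrow> \<Omega> s \<subseteq> f ` ball 0 r"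
proof -
  note f' = pointed_conformalD[OF f]
  have r: "0 < r" using assms \<rho> by simp
  have sub: "cball 0 r \<subseteq> ball (0::complex) 1" using assms by auto
  have cont: "continuous_on (cball 0 r) f"
    using f'(1) sub by (meson holomorphic_on_imp_continuous_on holomorphic_on_subset)
  define C where "C = f ` sphere 0 r"
  have "compact C" unfolding C_def
    using continuous_on_subset[OF cont sphere_cball] by (rule compact_continuous_image) simp
  have nz: "w \<noteq> 0" and inv: "inverse w \<in> \<psi> ` ball 0 1" if w: "w \<in> C" for w
  proof -
    obtain z where z: "cmod z = r" "w = f z" using w by (auto simp: C_def)
    have zb: "z \<in> ball 0 1" using z assms by auto
    have "f z \<noteq> f 0" using inj_onD[OF f'(2) _ zb, of 0] z r by auto
    then show "w \<noteq> 0" using z f' by simp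
    have "f z \<notin> f ` cball 0 \<rho>"
    proof
      assume "f z \<in> f ` cball 0 \<rho>"
      then obtain x where x: "f z = f x" "cmod x \<le> \<rho>" by auto
      have "z = x" using inj_onD[OF f'(2) x(1) zb] x \<rho> by auto
      then show False using x z assms by simp
    qed
    then show "inverse w \<in> \<psi> ` ball 0 1" unfolding \<psi>_image using z by (auto simp: outer_def)
  qed
  obtain k where k: "k holomorphic_on \<psi> ` ball 0 1"
    "\<And>w. w \<in> \<psi> ` ball 0 1 \<Longrightarrow> cmod (k w) < 1 \<and> \<psi> (k w) = w"
    using pointed_conformal_inverse[OF \<psi>] by metis
  have "compact (inverse ` C)"
    using \<open>compact C\<close> nz by (intro compact_continuous_image continuous_intros) auto
  then have "compact (k ` inverse ` C)"
  proof (rule compact_continuous_image[rotated])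
    show "continuous_on (inverse ` C) k"
      using inv by (intro continuous_on_subset[OF holomorphic_on_imp_continuous_on[OF k(1)]]) auto
  qed
  moreover have "k ` inverse ` C \<noteq> {}"
  proof -
    have "of_real r \<in> sphere (0::complex) r" using r by simp
    then show ?thesis unfolding C_def by blast
  qed
  ultimately obtain y where y: "y \<in> k ` inverse ` C" "\<And>x. x \<in> k ` inverse ` C \<Longrightarrow> cmod x \<le> cmod y"
    using continuous_attains_sup[of "k ` inverse ` C" cmod] by (auto intro: continuous_on_norm_id)
  show thesis
  proof (rule that[of "cmod y"])
    show "cmod y < 1" using y(1) k(2) inv by auto
    fix s assume s: "cmod y \<le> s" "0 < s" "s < 1"
    have disj: "w \<notin> \<Omega> s" if "w \<in> C" for w
    proof -
      have "cmod (k (inverse w)) \<le> s" using y(2)[of "k (inverse w)"] s(1) that by auto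
      moreover have "inverse w = \<psi> (k (inverse w))" using k(2)[OF inv[OF that]] by simp
      ultimately have "inverse w \<in> \<psi> ` cball 0 s" by auto
      then show ?thesis using nz[OF that] by (simp add: outer_def)
    qed
    have conn: "connected (\<Omega> s)"
      using outer_image_cball(2)[OF \<psi> s(2,3)] by (rule simply_connected_imp_connected)
    have "open (f ` ball 0 r)"
      using f'(1,2) sub ball_subset_cball by (metis holomorphic_on_subset inj_on_subset open_ball open_mapping_thm3 subset_trans)
    moreover have "closure (f ` ball 0 r) \<subseteq> f ` cball 0 r"
      using compact_continuous_image[OF cont compact_cball]
      by (intro closure_minimal image_mono ball_subset_cball compact_imp_closed)
    ultimately have "frontier (f ` ball 0 r) \<subseteq> f ` cball 0 r - f ` ball 0 r"
      by (auto simp: frontier_def interior_open)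
    also have "\<dots> \<subseteq> C"
    proof
      fix w assume w: "w \<in> f ` cball 0 r - f ` ball 0 r"
      then obtain z where z: "w = f z" "z \<in> cball 0 r" by blast
      have "z \<notin> ball 0 r" using w z(1) by blast
      then have "z \<in> sphere 0 r" using z(2) by simp
      then show "w \<in> C" unfolding C_def z(1) by (rule imageI)
    qed
    finally have fr: "\<Omega> s \<inter> frontier (f ` ball 0 r) = {}" using disj by blast
    have "f 0 \<in> f ` ball 0 r" using r by (intro imageI) simp
    then have "0 \<in> \<Omega> s \<inter> f ` ball 0 r" using f'(3) by (simp add: outer_def)
    then have ne: "\<Omega> s \<inter> f ` ball 0 r \<noteq> {}" by (metis empty_iff)
    show "\<Omega> s \<subseteq> f ` ball 0 r"
    proof (rule ccontr)
      assume "\<not> \<Omega> s \<subseteq> f ` ball 0 r"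
      then have "\<Omega> s - f ` ball 0 r \<noteq> {}" by (simp add: Diff_eq_empty_iff)
      from connected_Int_frontier[OF conn ne this] fr show False by contradiction
    qed
  qed
qed

text \<open>
Near \<open>0\<close> the map \<open>\<psi>\<close> is almost the multiplication by \<open>\<psi>'(0)\<close>, so the complement of \<open>\<Omega> s\<close> is almost the
exterior of the disc of radius \<open>1 / (s \<psi>'(0))\<close>.
\<close>

lemma \<Omega>_almost_disc:
  assumes "0 < \<delta>"
  obtains s R where "0 < s" "s < 1" "0 < R" "\<Omega> s \<subseteq> ball 0 R" "R \<le> exp \<delta> * conformal_radius (G s)"
proof -
  note p = pointed_conformalD[OF \<psi>]
  define c where "c = conformal_radius \<psi>"
  define q where "q = exp (\<delta> / 2)"
  have c: "0 < c" using p by (simp add: c_def)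
  have q: "1 < q" "0 < q" "q * q = exp \<delta>" using assms by (simp_all add: q_def flip: exp_add)
  obtain k where k: "\<And>z. cmod z < 1 \<Longrightarrow> k (\<psi> z) = z"
    "\<And>w. w \<in> \<psi> ` ball 0 1 \<Longrightarrow> cmod (k w) < 1 \<and> \<psi> (k w) = w"
    "(k has_field_derivative of_real (inverse c)) (at 0)"
    using pointed_conformal_inverse[OF \<psi>] unfolding c_def by metis
  have k0: "k 0 = 0" using k(1)[of 0] p(3) by simp
  obtain \<eta>1 where \<eta>1: "0 < \<eta>1" "\<And>z. cmod z \<le> \<eta>1 \<Longrightarrow> cmod (\<psi> z) \<le> q * c * cmod z"
    using norm_le_near_0[OF p(9)[folded c_def] p(3) c q(1)] by blast
  obtain \<eta>2 where \<eta>2: "0 < \<eta>2" "\<And>z. cmod z \<le> \<eta>2 \<Longrightarrow> cmod (k z) \<le> q * inverse c * cmod z"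
    using norm_le_near_0[OF k(3) k0 _ q(1)] c by auto
  obtain \<eta>3 where \<eta>3: "0 < \<eta>3" "cball 0 \<eta>3 \<subseteq> \<psi> ` ball 0 1"
    using p(7,8) by (meson open_contains_cball)
  define s where "s = min (1 / 2) (min \<eta>1 (q * min \<eta>2 \<eta>3 / c))"
  have s: "0 < s" "s < 1" "s \<le> \<eta>1" using \<eta>1(1) \<eta>2(1) \<eta>3(1) c q by (auto simp: s_def)
  have "s \<le> q * min \<eta>2 \<eta>3 / c" by (simp add: s_def)
  then have "s * c / q \<le> min \<eta>2 \<eta>3" using c q by (simp add: field_simps del: min_less_iff_conj min.bounded_iff)
  then have s': "s * c / q \<le> \<eta>2" "s * c / q \<le> \<eta>3" by simp_all
  define R where "R = q / (s * c)"
  show thesis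
  proof (rule that[OF s(1,2)])
    show "0 < R" using q s c by (simp add: R_def)
    show "\<Omega> s \<subseteq> ball 0 R"
    proof
      fix w assume w: "w \<in> \<Omega> s"
      show "w \<in> ball 0 R"
      proof (rule ccontr)
        assume "w \<notin> ball 0 R"
        then have wR: "R \<le> cmod w" by simp
        then have nz: "w \<noteq> 0" using \<open>0 < R\<close> by auto
        have u: "cmod (inverse w) \<le> s * c / q"
          using wR nz q s c by (simp add: R_def norm_inverse norm_divide field_simps)
        have "cmod (k (inverse w)) \<le> q * inverse c * cmod (inverse w)" using \<eta>2(2) u s'(1) by simp
        also have "\<dots> \<le> q * inverse c * (s * c / q)" using u c q by (intro mult_left_mono) auto
        also have "\<dots> = s" using c q by simp
        finally have "cmod (k (inverse w)) \<le> s" .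
        moreover have "inverse w \<in> cball 0 \<eta>3" using u s'(2) by simp
        then have "\<psi> (k (inverse w)) = inverse w" using \<eta>3(2) k(2) by blast
        ultimately have "inverse w \<in> \<psi> ` cball 0 s" by (metis image_eqI mem_cball_0)
        then show False using w nz by (simp add: outer_def)
      qed
    qed
    \<comment> \<open>the inner radius \<open>r\<close> and the outer radius \<open>R\<close> differ by the factor \<open>q\<^sup>2 = exp \<delta>\<close>\<close>
    define r where "r = 1 / (q * c * s)"
    have r: "0 < r" "exp \<delta> * r = R" using q s c by (auto simp: r_def R_def q(3)[symmetric])
    have "ball 0 r \<subseteq> \<Omega> s"
    proof
      fix w :: complex assume w: "w \<in> ball 0 r"
      show "w \<in> \<Omega> s"
      proof (rule ccontr)
        assume "w \<notin> \<Omega> s"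
        then obtain z where z: "w \<noteq> 0" "inverse w = \<psi> z" "cmod z \<le> s" by (auto simp: outer_def)
        have "cmod (inverse w) \<le> q * c * cmod z" using \<eta>1(2)[of z] z s by simp
        also have "\<dots> \<le> q * c * s" using z q c by (intro mult_left_mono) auto
        finally have "r \<le> cmod w" using z(1) q c s by (simp add: r_def norm_inverse norm_divide field_simps)
        then show False using w by simp
      qed
    qed
    then have "cmod (deriv (\<lambda>z. of_real r * z) 0) \<le> conformal_radius (G s)"
      using pointed_conformal_disc(3)[OF r(1)] pointed_conformalD(1,3)[OF pointed_conformal_disc(1)[OF r(1)]]
      by (intro conformal_radius_maximal G s) (auto simp: G_image s)
    then have "r \<le> conformal_radius (G s)"
      using pointed_conformalD(5)[OF pointed_conformal_disc(1)[OF r(1)]] pointed_conformal_disc(2)[OF r(1)] r(1)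
      by simp
    then show "R \<le> exp \<delta> * conformal_radius (G s)" using r(2) by (metis exp_ge_zero mult_left_mono)
  qed
qed

text \<open>
The conformal radius does not jump down after \<open>s\<close>: the open sets \<open>\<Omega> t\<close> with \<open>t > s\<close> exhaust \<open>\<Omega> s\<close>, so
one of them contains the image under \<open>G s\<close> of a given disc of radius less than \<open>1\<close>.
\<close>

lemma radius_lower_after:
  assumes \<delta>: "0 < \<delta>" and s: "0 < s" "s < 1"
  obtains t where "s < t" "t < 1" "conformal_radius (G s) \<le> exp \<delta> * conformal_radius (G t)"
proof -
  define q where "q = exp (- \<delta>)"
  have q: "0 < q" "q < 1" "exp \<delta> * q = 1" using \<delta> by (simp_all add: q_def flip: exp_add)
  note g = pointed_conformalD[OF G[OF s]] and p = pointed_conformalD[OF \<psi>]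
  define K where "K = G s ` cball 0 q"
  have "compact K"
    unfolding K_def using q g(1)
    by (intro compact_continuous_image continuous_on_subset[OF holomorphic_on_imp_continuous_on[OF g(1)]]) auto
  have K_sub: "K \<subseteq> \<Omega> s" unfolding K_def G_image[OF s, symmetric] using q by auto
  have cover: "K \<subseteq> (\<Union>t\<in>{s<..<1}. \<Omega> t)"
  proof
    fix w assume "w \<in> K"
    then have w: "w \<in> \<Omega> s" using K_sub by blast
    show "w \<in> (\<Union>t\<in>{s<..<1}. \<Omega> t)"
    proof (cases "w \<noteq> 0 \<and> inverse w \<in> \<psi> ` ball 0 1")
      case True
      then obtain z where z: "inverse w = \<psi> z" "cmod z < 1" by auto
      have sz: "s < cmod z" using w True z by (force simp: outer_def)
      define t where "t = (s + cmod z) / 2"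
      have t: "s < t" "t < cmod z" "t < 1" using sz z by (auto simp: t_def)
      have "inverse w \<notin> \<psi> ` cball 0 t"
      proof
        assume "inverse w \<in> \<psi> ` cball 0 t"
        then obtain y where y: "\<psi> z = \<psi> y" "cmod y \<le> t" using z by auto
        have "z = y" using inj_onD[OF p(2) y(1)] z y t by auto
        then show False using y t by simp
      qed
      then show ?thesis using t by (auto simp: outer_def)
    next
      case False
      have "w \<in> \<Omega> ((s + 1) / 2)"
      proof (cases "w = 0")
        case nz: False
        then have "inverse w \<notin> \<psi> ` cball 0 ((s + 1) / 2)" using False s by (auto simp: image_iff)
        then show ?thesis by (simp add: outer_def)
      qed (simp add: outer_def)
      then show ?thesis using s by (intro UN_I[of "(s + 1) / 2"]) auto
    qed
  qed
  obtain D where D: "D \<subseteq> {s<..<1}" "finite D" "K \<subseteq> (\<Union>t\<in>D. \<Omega> t)"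
  proof (rule compactE_image[OF \<open>compact K\<close> _ cover])
    show "open (\<Omega> t)" if "t \<in> {s<..<1}" for t
      using that s outer_image_cball(1)[OF \<psi>, of t] by simp
  qed
  define t where "t = Min (insert ((s + 1) / 2) D)"
  have "t \<in> insert ((s + 1) / 2) D" unfolding t_def using D(2) by (intro Min_in) auto
  then have t: "s < t" "t < 1" using D(1) s by auto
  have "\<Omega> x \<subseteq> \<Omega> t" if "x \<in> D" for x
    using that D(2) by (intro \<Omega>_antimono) (simp add: t_def)
  then have "K \<subseteq> \<Omega> t" using D(3) by blast
  let ?u = "\<lambda>z. G s (of_real q * z)"
  note u = pointed_conformal_scale[OF G[OF s] q(1) less_imp_le[OF q(2)]]
  have "?u ` ball 0 1 \<subseteq> K" unfolding u(3) K_def by auto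
  then have "cmod (deriv ?u 0) \<le> conformal_radius (G t)"
    using pointed_conformalD(1,3)[OF u(1)] t s \<open>K \<subseteq> \<Omega> t\<close>
    by (intro conformal_radius_maximal G) (auto simp: G_image)
  then have "q * conformal_radius (G s) \<le> conformal_radius (G t)"
    using pointed_conformalD(4,5)[OF u(1)] u(2) by (simp only: norm_of_real)
  then have "exp \<delta> * (q * conformal_radius (G s)) \<le> exp \<delta> * conformal_radius (G t)" by simp
  then have "conformal_radius (G s) \<le> exp \<delta> * conformal_radius (G t)" using q(3) by (simp add: mult.assoc[symmetric])
  then show thesis using t that by blast
qed

text \<open>
The conformal radius does not jump down on reaching \<open>s\<close> either. The Riemann maps of \<open>\<Omega> t\<close> for \<open>t < s\<close>
form a normal family; the image of a limit function is open and omits \<open>1 / \<psi>\<close> of the open punctured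
disc of radius \<open>s\<close>, hence also its boundary, so it lies in \<open>\<Omega> s\<close>.
\<close>

lemma radius_upper_before:
  assumes \<delta>: "0 < \<delta>" and s: "0 < s" "s < 1"
  shows "\<exists>t. 0 < t \<and> t < s \<and> conformal_radius (G t) \<le> exp \<delta> * conformal_radius (G s)"
proof (rule ccontr)
  assume "\<not> ?thesis"
  then have large: "exp \<delta> * conformal_radius (G s) < conformal_radius (G t)" if "0 < t" "t < s" for t
    using that not_le by blast
  note p = pointed_conformalD[OF \<psi>]
  define \<tau> where "\<tau> n = s - s / (real n + 2)" for n :: nat
  have \<tau>: "0 < \<tau> n" "\<tau> n < s" "\<tau> n < 1" "s / 2 \<le> \<tau> n" for n
  proof -
    have "0 < s / (real n + 2)" using s by simp
    moreover have "s / (real n + 2) \<le> s / 2" by (rule frac_le) (use s in auto)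
    ultimately show "0 < \<tau> n" "\<tau> n < s" "\<tau> n < 1" "s / 2 \<le> \<tau> n" using s unfolding \<tau>_def by linarith+
  qed
  have \<tau>_lim: "\<tau> \<longlonglongrightarrow> s"
  proof -
    have "(\<lambda>n. s - s / (real n + 2)) \<longlonglongrightarrow> s - 0"
      by (intro tendsto_intros tendsto_divide_0[OF tendsto_const] filterlim_at_top_imp_at_infinity
          filterlim_tendsto_add_at_top[where f = "\<lambda>_. 2", simplified add.commute] filterlim_real_sequentially)
        (auto simp: add.commute)
    then show ?thesis by (simp add: \<tau>_def[abs_def])
  qed
  define \<H> where "\<H> = {h. h holomorphic_on ball 0 1 \<and> h ` ball 0 1 \<subseteq> \<Omega> (s / 2)}"
  have \<H>: "G (\<tau> n) \<in> \<H>" for n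
    using pointed_conformalD(1)[OF G[OF \<tau>(1,3)]] G_image[OF \<tau>(1,3)] \<Omega>_antimono[OF \<tau>(4)]
    by (simp add: \<H>_def)
  obtain B where B: "\<And>w. w \<in> \<Omega> (s / 2) \<Longrightarrow> cmod w \<le> B"
    using outer_image_cball(4)[OF \<psi>, of "s / 2"] s by (auto simp: bounded_iff)
  obtain g r where g: "g holomorphic_on ball 0 1" "strict_mono (r :: nat \<Rightarrow> nat)"
    "\<And>x. x \<in> ball 0 1 \<Longrightarrow> (\<lambda>n. G (\<tau> (r n)) x) \<longlonglongrightarrow> g x"
    "\<And>K. compact K \<Longrightarrow> K \<subseteq> ball 0 1 \<Longrightarrow> uniform_limit K ((\<lambda>n. G (\<tau> n)) \<circ> r) g sequentially"
  proof (rule Montel[of "ball 0 1" \<H> "\<lambda>n. G (\<tau> n)"])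
    show "\<exists>b. \<forall>h\<in>\<H>. \<forall>z\<in>K. cmod (h z) \<le> b" if "compact K" "K \<subseteq> ball 0 1" for K
      using that B unfolding \<H>_def by (intro exI[of _ B]) blast
    show "range (\<lambda>n. G (\<tau> n)) \<subseteq> \<H>" using \<H> by blast
    show "h holomorphic_on ball 0 1" if "h \<in> \<H>" for h using that by (simp add: \<H>_def)
  qed (use that in auto)
  have \<tau>r: "(\<lambda>n. \<tau> (r n)) \<longlonglongrightarrow> s"
    using LIMSEQ_subseq_LIMSEQ[OF \<tau>_lim g(2)] by (simp add: o_def)
  have "(\<lambda>n. G (\<tau> (r n)) 0) \<longlonglongrightarrow> 0"
    using pointed_conformalD(3)[OF G[OF \<tau>(1,3)]] by simp
  then have g0: "g 0 = 0" using g(3)[of 0] LIMSEQ_unique by auto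
  have "uniform_limit (ball 0 (1 / 2)) ((\<lambda>n. G (\<tau> n)) \<circ> r) g sequentially"
    by (rule uniform_limit_on_subset[OF g(4)[of "cball 0 (1 / 2)"]]) auto
  then have "(\<lambda>n. deriv (((\<lambda>n. G (\<tau> n)) \<circ> r) n) 0) \<longlonglongrightarrow> deriv g 0"
  proof (rule deriv_complex_uniform_limit)
    have "G (\<tau> (r n)) holomorphic_on ball 0 (1 / 2)" for n
      using pointed_conformalD(1)[OF G[OF \<tau>(1,3)]] by (rule holomorphic_on_subset) auto
    then show "\<forall>\<^sub>F n in sequentially. ((\<lambda>n. G (\<tau> n)) \<circ> r) n holomorphic_on ball 0 (1 / 2)"
      by simp
  qed auto
  then have "(\<lambda>n. Re (deriv (G (\<tau> (r n))) 0)) \<longlonglongrightarrow> Re (deriv g 0)"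
    by (intro tendsto_Re) (simp add: o_def)
  then have Re_large: "exp \<delta> * conformal_radius (G s) \<le> Re (deriv g 0)"
  proof (rule tendsto_lowerbound)
    have "exp \<delta> * conformal_radius (G s) \<le> Re (deriv (G (\<tau> (r n))) 0)" for n
      using large[OF \<tau>(1,2)] unfolding conformal_radius_def by (rule less_imp_le)
    then show "\<forall>\<^sub>F n in sequentially. exp \<delta> * conformal_radius (G s) \<le> Re (deriv (G (\<tau> (r n))) 0)"
      by simp
  qed simp
  have rs: "0 < conformal_radius (G s)" using pointed_conformalD(4)[OF G[OF s]] .
  then have "0 < exp \<delta> * conformal_radius (G s)" by simp
  with Re_large have d_nz: "deriv g 0 \<noteq> 0" by auto
  have op: "open (g ` ball 0 1)"
  proof (rule open_mapping_thm[OF g(1)])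
    show "\<not> g constant_on ball 0 1"
    proof
      assume "g constant_on ball 0 1"
      then obtain c where c: "\<forall>z\<in>ball 0 1. g z = c" unfolding constant_on_def by blast
      have "(g has_field_derivative 0) (at 0)"
        by (rule has_field_derivative_transform_within_open[of "\<lambda>_. c" _ _ "ball 0 1"]) (use c in simp_all)
      then show False using d_nz by (simp add: DERIV_imp_deriv)
    qed
  qed auto
  have "g ` ball 0 1 \<subseteq> \<Omega> s"
  proof
    fix w assume w: "w \<in> g ` ball 0 1"
    show "w \<in> \<Omega> s"
    proof (rule ccontr)
      assume "w \<notin> \<Omega> s"
      then obtain z0 where z0: "w \<noteq> 0" "inverse w = \<psi> z0" "cmod z0 \<le> s" by (auto simp: outer_def)
      have z0b: "z0 \<in> ball 0 1" using z0 s by auto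
      have z0nz: "z0 \<noteq> 0" using z0 p(3) by auto
      have "isCont \<psi> z0" using holomorphic_derivI[OF p(1) open_ball z0b] by (rule DERIV_isCont)
      moreover have "((\<lambda>x. of_real x * z0) \<longlongrightarrow> of_real 1 * z0) (at_left (1::real))"
        by (intro tendsto_intros)
      ultimately have "((\<lambda>x. \<psi> (of_real x * z0)) \<longlongrightarrow> \<psi> z0) (at_left (1::real))"
        by (intro isCont_tendsto_compose[of z0 \<psi>]) auto
      then have "((\<lambda>x. inverse (\<psi> (of_real x * z0))) \<longlongrightarrow> inverse (\<psi> z0)) (at_left (1::real))"
        using z0 by (intro tendsto_inverse) auto
      then have "((\<lambda>x. inverse (\<psi> (of_real x * z0))) \<longlongrightarrow> w) (at_left (1::real))"
        using z0(2) by (metis inverse_inverse_eq)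
      then have "\<forall>\<^sub>F x in at_left (1::real). inverse (\<psi> (of_real x * z0)) \<in> g ` ball 0 1"
        using op w by (rule topological_tendstoD)
      moreover have "\<forall>\<^sub>F x in at_left (1::real). x \<in> {0<..<1}"
        by (rule eventually_at_left_real) simp
      ultimately have "\<forall>\<^sub>F x in at_left (1::real). x \<in> {0<..<1} \<and> inverse (\<psi> (of_real x * z0)) \<in> g ` ball 0 1"
        by eventually_elim simp
      then obtain x where x: "0 < x" "x < 1" "inverse (\<psi> (of_real x * z0)) \<in> g ` ball 0 1"
        using eventually_happens'[OF trivial_limit_at_left_real] by force
      \<comment> \<open>\<open>z0\<close> may lie on the circle of radius \<open>s\<close>; moving it inwards keeps \<open>1 / \<psi>\<close> in the open image of \<open>g\<close>\<close>
      define z1 where "z1 = of_real x * z0"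
      have z1: "cmod z1 < s" "z1 \<noteq> 0" "z1 \<in> ball 0 1"
      proof -
        have "cmod z1 < cmod z0" using x z0nz by (simp add: z1_def norm_mult)
        then show "cmod z1 < s" "z1 \<in> ball 0 1" using z0 s by auto
        show "z1 \<noteq> 0" using x z0nz by (simp add: z1_def)
      qed
      obtain y where y: "y \<in> ball 0 1" "inverse (\<psi> z1) = g y" using x(3) by (auto simp: z1_def)
      have \<psi>nz: "\<psi> z1 \<noteq> 0" using inj_onD[OF p(2), of z1 0] z1 p(3) by auto
      then have gy: "g y \<noteq> 0" by (simp flip: y(2))
      define m where "m = (cmod z1 + s) / 2"
      have m: "cmod z1 < m" "m < s" "m < 1" using z1 s by (auto simp: m_def)
      have lim: "(\<lambda>n. G (\<tau> (r n)) y) \<longlonglongrightarrow> g y" by (rule g(3)[OF y(1)])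
      then have "(\<lambda>n. inverse (G (\<tau> (r n)) y)) \<longlonglongrightarrow> \<psi> z1"
        using tendsto_inverse[OF lim gy] by (simp flip: y(2))
      moreover have "open (\<psi> ` ball 0 m)"
      proof (rule open_mapping_thm3[OF _ open_ball])
        have "ball 0 m \<subseteq> ball (0::complex) 1" using m(3) by auto
        then show "\<psi> holomorphic_on ball 0 m" "inj_on \<psi> (ball 0 m)"
          using p(1,2) by (auto intro: holomorphic_on_subset inj_on_subset)
      qed
      moreover have "\<psi> z1 \<in> \<psi> ` ball 0 m" using m(1) by auto
      ultimately have "\<forall>\<^sub>F n in sequentially. inverse (G (\<tau> (r n)) y) \<in> \<psi> ` ball 0 m"
        by (rule topological_tendstoD)
      moreover have "\<forall>\<^sub>F n in sequentially. G (\<tau> (r n)) y \<noteq> 0"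
        using tendsto_imp_eventually_ne[OF lim gy] .
      moreover have "\<forall>\<^sub>F n in sequentially. m < \<tau> (r n)"
        using order_tendstoD(1)[OF \<tau>r m(2)] .
      ultimately have "\<forall>\<^sub>F n in sequentially. inverse (G (\<tau> (r n)) y) \<in> \<psi> ` ball 0 m \<and>
          G (\<tau> (r n)) y \<noteq> 0 \<and> m < \<tau> (r n)"
        by eventually_elim simp
      then obtain n where n: "inverse (G (\<tau> (r n)) y) \<in> \<psi> ` ball 0 m" "G (\<tau> (r n)) y \<noteq> 0" "m < \<tau> (r n)"
        using eventually_happens'[OF sequentially_bot] by blast
      have "G (\<tau> (r n)) y \<in> \<Omega> (\<tau> (r n))" using y(1) G_image[OF \<tau>(1,3)] by blast
      then have "inverse (G (\<tau> (r n)) y) \<notin> \<psi> ` cball 0 (\<tau> (r n))" using n(2) by (simp add: outer_def)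
      moreover have "\<psi> ` ball 0 m \<subseteq> \<psi> ` cball 0 (\<tau> (r n))" using n(3) by (intro image_mono) auto
      ultimately show False using n(1) by blast
    qed
  qed
  then have "cmod (deriv g 0) \<le> conformal_radius (G s)"
    using g(1) g0 s by (intro conformal_radius_maximal G) (auto simp: G_image)
  then have "exp \<delta> * conformal_radius (G s) \<le> conformal_radius (G s)"
    using Re_large complex_Re_le_cmod[of "deriv g 0"] by linarith
  then show False using \<delta> rs by simp
qed

text \<open>
Since the conformal radius is continuous in \<open>s\<close>, a chain that has reached \<open>\<Omega> s\<close> can be prolonged, and
the supremum of the parameters reached is \<open>1\<close>.
\<close>

lemma loewner_chain_inner:
  assumes \<delta>: "0 < \<delta>"
  shows "loewner_chain \<delta> (\<lambda>z. f (of_real \<rho> * z))"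
proof -
  have shrink_\<Omega>: "loewner_chain \<delta> (G t)"
    if "loewner_chain \<delta> (G s)" "0 < s" "s \<le> t" "t < 1" "conformal_radius (G s) \<le> exp \<delta> * conformal_radius (G t)" for s t
    using that \<Omega>_antimono[of s t] by (intro loewner_chain.shrink[OF that(1)] G) (auto simp: G_image)
  define S where "S = {s. 0 < s \<and> s < 1 \<and> loewner_chain \<delta> (G s)}"
  obtain s0 where s0: "s0 \<in> S"
  proof -
    obtain s R where s: "0 < s" "s < 1" and R: "0 < R" "\<Omega> s \<subseteq> ball 0 R" "R \<le> exp \<delta> * conformal_radius (G s)"
      using \<Omega>_almost_disc[OF \<delta>] by blast
    have "loewner_chain \<delta> (G s)"
      using R by (intro loewner_chain.shrink[OF loewner_chain.disc[OF R(1)]] G s)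
        (simp_all add: G_image s pointed_conformal_disc)
    then show thesis using s that by (auto simp: S_def)
  qed
  have far: "\<exists>s\<in>S. t < s" if t: "t < 1" for t
  proof (rule ccontr)
    assume "\<not> (\<exists>s\<in>S. t < s)"
    then have ub: "\<And>s. s \<in> S \<Longrightarrow> s \<le> t" by (meson not_le_imp_less)
    then have bdd: "bdd_above S" by (auto simp: bdd_above_def)
    define \<sigma> where "\<sigma> = Sup S"
    have "s0 \<le> \<sigma>" unfolding \<sigma>_def using s0 bdd by (rule cSup_upper)
    then have \<sigma>0: "0 < \<sigma>" using s0 by (auto simp: S_def)
    have "\<sigma> \<le> t" unfolding \<sigma>_def using s0 ub by (intro cSup_least) auto
    then have \<sigma>1: "\<sigma> < 1" using t by simp
    obtain u where u: "0 < u" "u < \<sigma>" "conformal_radius (G u) \<le> exp \<delta> * conformal_radius (G \<sigma>)"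
      using radius_upper_before[OF \<delta> \<sigma>0 \<sigma>1] by blast
    obtain s where s: "s \<in> S" "u < s" using less_cSupD[of S u] u(2) s0 unfolding \<sigma>_def by blast
    then have s': "0 < s" "s < 1" "loewner_chain \<delta> (G s)" by (auto simp: S_def)
    have "s \<le> \<sigma>" unfolding \<sigma>_def using s(1) bdd by (rule cSup_upper)
    have "conformal_radius (G s) \<le> conformal_radius (G u)"
      using s(2) s'(2) u(1) by (intro radius_antimono) auto
    then have "conformal_radius (G s) \<le> exp \<delta> * conformal_radius (G \<sigma>)"
      using u(3) by (rule order_trans)
    then have \<sigma>_chain: "loewner_chain \<delta> (G \<sigma>)"
      by (rule shrink_\<Omega>[OF s'(3,1) \<open>s \<le> \<sigma>\<close> \<sigma>1])
    obtain v where v: "\<sigma> < v" "v < 1" "conformal_radius (G \<sigma>) \<le> exp \<delta> * conformal_radius (G v)"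
      using radius_lower_after[OF \<delta> \<sigma>0 \<sigma>1] by blast
    have "loewner_chain \<delta> (G v)"
      by (rule shrink_\<Omega>[OF \<sigma>_chain \<sigma>0 less_imp_le[OF v(1)] v(2,3)])
    then have "v \<in> S" using v \<sigma>0 by (simp add: S_def)
    then have "v \<le> \<sigma>" unfolding \<sigma>_def using bdd by (rule cSup_upper)
    then show False using v by simp
  qed
  \<comment> \<open>\<open>\<Omega> s\<close> is squeezed into \<open>f ` ball 0 r\<close>, so the last step has ratio at most \<open>r / \<rho> \<le> exp \<delta>\<close>\<close>
  define r where "r = min (exp \<delta> * \<rho>) ((1 + \<rho>) / 2)"
  have r: "\<rho> < r" "r < 1" "r \<le> exp \<delta> * \<rho>" using \<rho> \<delta> by (auto simp: r_def min_less_iff_disj)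
  have r0: "0 < r" "r \<le> 1" using r \<rho> by auto
  obtain t where t: "t < 1" "\<And>s. t \<le> s \<Longrightarrow> 0 < s \<Longrightarrow> s < 1 \<Longrightarrow> \<Omega> s \<subseteq> f ` ball 0 r"
    using \<Omega>_near_boundary[OF r(1,2)] by blast
  obtain s where s: "s \<in> S" "t < s" using far[OF t(1)] by blast
  then have s': "0 < s" "s < 1" "loewner_chain \<delta> (G s)" by (auto simp: S_def)
  have \<Omega>r: "\<Omega> s \<subseteq> f ` ball 0 r" using t(2)[of s] s s' by simp
  note sc = pointed_conformal_scale[OF f r0]
  have "cmod (deriv (G s) 0) \<le> conformal_radius (\<lambda>z. f (of_real r * z))"
    using pointed_conformalD(1,3)[OF G[OF s'(1,2)]] \<Omega>r
    by (intro conformal_radius_maximal sc(1)) (auto simp: sc(3) G_image s')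
  then have "conformal_radius (G s) \<le> r * conformal_radius f"
    using pointed_conformalD(4,5)[OF G[OF s'(1,2)]] sc(2) by simp
  also have "\<dots> \<le> exp \<delta> * \<rho> * conformal_radius f"
    using r(3) pointed_conformalD(4)[OF f] by (intro mult_right_mono) auto
  finally have rad: "conformal_radius (G s) \<le> exp \<delta> * \<rho> * conformal_radius f" .
  note sc' = pointed_conformal_scale[OF f \<rho>(1) less_imp_le[OF \<rho>(2)]]
  show ?thesis
  proof (rule loewner_chain.shrink[OF s'(3) sc'(1)])
    show "(\<lambda>z. f (of_real \<rho> * z)) ` ball 0 1 \<subseteq> G s ` ball 0 1"
      unfolding sc'(3) G_image[OF s'(1,2)] using inner_subset[OF s'(2)] by auto
    show "conformal_radius (G s) \<le> exp \<delta> * conformal_radius (\<lambda>z. f (of_real \<rho> * z))"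
      unfolding sc'(2) using rad by (simp add: mult.assoc)
  qed
qed

end

theorem loewner_chain_dilation:
  assumes f: "pointed_conformal f" and \<rho>: "0 < \<rho>" "\<rho> < 1" and \<delta>: "0 < \<delta>"
  shows "loewner_chain \<delta> (\<lambda>z. f (of_real \<rho> * z))"
proof -
  have zero: "0 \<in> outer K" for K by (simp add: outer_def)
  obtain \<psi> where \<psi>: "pointed_conformal \<psi>" "\<psi> ` ball 0 1 = outer (f ` cball 0 \<rho>)"
    by (rule pointed_riemann_map[OF outer_image_cball(1-3)[OF f \<rho>] zero])
  have "\<exists>g. pointed_conformal g \<and> g ` ball 0 1 = outer (\<psi> ` cball 0 s)" if "0 < s" "s < 1" for s
    by (rule pointed_riemann_map[OF outer_image_cball(1-3)[OF \<psi>(1) that] zero]) blast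
  then obtain G where "\<And>s. 0 < s \<Longrightarrow> s < 1 \<Longrightarrow> pointed_conformal (G s) \<and> G s ` ball 0 1 = outer (\<psi> ` cball 0 s)"
    by metis
  then interpret exterior_exhaustion f \<psi> \<rho> G
    using f \<rho> \<psi> by unfold_locales auto
  show ?thesis using \<delta> by (rule loewner_chain_inner)
qed

section \<open>Coefficient bounds for univalent functions\<close>

lemma ncoeff_linear_change:
  assumes f: "f holomorphic_on ball 0 1" and uv: "u \<noteq> 0" "v \<noteq> 0" and n: "0 < n"
  shows "ncoeff (\<lambda>z. u * f (v * z)) n = v ^ (n - 1) * ncoeff f n"
proof -
  have F: "f has_fps_expansion fps_expansion f 0"
    by (rule has_fps_expansion_fps_expansion[OF _ _ f]) auto
  have "(\<lambda>z. v * z) has_fps_expansion fps_const v * fps_X"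
    by (intro fps_expansion_intros)
  from has_fps_expansion_compose[OF F this]
  have "(\<lambda>z. f (v * z)) has_fps_expansion fps_compose (fps_expansion f 0) (fps_const v * fps_X)"
    by (simp add: o_def)
  then have "(\<lambda>z. u * f (v * z)) has_fps_expansion fps_const u * fps_compose (fps_expansion f 0) (fps_const v * fps_X)"
    by (rule has_fps_expansion_cmult_left)
  then have "fps_expansion (\<lambda>z. u * f (v * z)) 0 = fps_const u * fps_compose (fps_expansion f 0) (fps_const v * fps_X)"
    by (rule fps_expansion_eqI)
  then show ?thesis
    using uv n by (cases n) (simp_all add: ncoeff_def fps_compose_linear)
qed

lemma le_of_le_near_0:
  fixes F :: "real \<Rightarrow> real"
  assumes "continuous_on UNIV F" and "\<And>\<delta>. 0 < \<delta> \<Longrightarrow> \<delta> < 1 / 3 \<Longrightarrow> x \<le> F \<delta>"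
  shows "x \<le> F 0"
proof -
  have "(F \<longlongrightarrow> F 0) (at_right 0)"
    using assms(1) by (meson UNIV_I continuous_on_def tendsto_within_subset subset_UNIV)
  moreover have "\<forall>\<^sub>F \<delta> in at_right (0::real). x \<le> F \<delta>"
  proof (rule eventually_mono)
    show "\<forall>\<^sub>F \<delta> in at_right 0. \<delta> \<in> {0<..<1 / 3 :: real}" by (rule eventually_at_right_real) simp
  qed (auto intro: assms(2))
  ultimately show ?thesis by (rule tendsto_lowerbound) auto
qed

text \<open>
The dilations \<open>f (r z)\<close> lie at the end of chains with arbitrarily small steps \<open>\<delta>\<close>; then \<open>\<delta>\<close> tends
to \<open>0\<close> and \<open>r\<close> tends to \<open>1\<close>.
\<close>

lemma inverse_coeff_bounds:
  assumes f: "pointed_conformal f"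
  shows "cmod (inv2 f) \<le> 2" and "cmod (inv3 f) \<le> 5" and "cmod (inv4 f) \<le> 14"
    and "Re (ncoeff f 3) \<le> 3"
proof -
  have scaled: "r * cmod (inv2 f) \<le> 2 \<and> r\<^sup>2 * cmod (inv3 f) \<le> 5 \<and> r ^ 3 * cmod (inv4 f) \<le> 14 \<and>
      r\<^sup>2 * Re (ncoeff f 3) \<le> 3" if r: "0 < r" "r < 1" for r
  proof -
    define g where "g = (\<lambda>z. f (of_real r * z))"
    have a: "ncoeff g n = of_real r ^ (n - 1) * ncoeff f n" if "0 < n" for n
      using ncoeff_linear_change[OF pointed_conformalD(1)[OF f], of 1 "of_real r" n] r that
      by (simp add: g_def)
    have inv: "inv2 g = of_real r * inv2 f" "inv3 g = of_real (r\<^sup>2) * inv3 f" "inv4 g = of_real (r ^ 3) * inv4 f"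
      by (simp_all add: inv2_def inv3_def inv4_def a power2_eq_square power3_eq_cube algebra_simps)
    have a3: "ncoeff g 3 = of_real (r\<^sup>2) * ncoeff f 3" by (simp add: a)
    have "cmod (inv2 g) \<le> 2 + 2 * \<delta> \<and> cmod (inv3 g) \<le> 5 + 24 * \<delta> \<and> cmod (inv4 g) \<le> 14 + 204 * \<delta> \<and>
        Re (ncoeff g 3) \<le> 3 + 2 * \<delta> * exp \<delta> + 4 * (exp \<delta> ^ 2 - 1)" if \<delta>: "0 < \<delta>" "\<delta> < 1 / 3" for \<delta>
    proof -
      have chain: "loewner_chain \<delta> g" unfolding g_def by (rule loewner_chain_dilation[OF f r \<delta>(1)])
      note bounds = loewner_chain_bounds[OF chain less_imp_le[OF \<delta>(1)] less_imp_le[OF \<delta>(2)]]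
      have "Re (ncoeff g 3) = Re (ncoeff g 2 ^ 2) + Re (ncoeff g 3 - ncoeff g 2 ^ 2)" by simp
      also have "\<dots> \<le> (Re (ncoeff g 2))\<^sup>2 + Re (ncoeff g 3 - ncoeff g 2 ^ 2)"
        by (simp add: Re_power2)
      also have "\<dots> \<le> 3 + 2 * \<delta> * exp \<delta> + 4 * (exp \<delta> ^ 2 - 1)"
        using bounds \<delta> by (intro loewner_energy_bound) auto
      finally show ?thesis using bounds by blast
    qed
    then have "cmod (inv2 g) \<le> 2 + 2 * 0" "cmod (inv3 g) \<le> 5 + 24 * 0" "cmod (inv4 g) \<le> 14 + 204 * 0"
      "Re (ncoeff g 3) \<le> 3 + 2 * 0 * exp 0 + 4 * (exp 0 ^ 2 - 1)"
      by - (rule le_of_le_near_0; auto intro!: continuous_intros)+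
    then show ?thesis using r by (simp add: inv a3 norm_mult flip: of_real_power)
  qed
  have "1 * cmod (inv2 f) \<le> 2" "1\<^sup>2 * cmod (inv3 f) \<le> 5" "1 ^ 3 * cmod (inv4 f) \<le> 14" "1\<^sup>2 * Re (ncoeff f 3) \<le> 3"
    using scaled by - (rule le_of_scaled_le_near_1; auto intro!: continuous_intros)+
  then show "cmod (inv2 f) \<le> 2" "cmod (inv3 f) \<le> 5" "cmod (inv4 f) \<le> 14" "Re (ncoeff f 3) \<le> 3"
    by simp_all
qed

text \<open>
A rotation of \<open>f\<close> by \<open>v\<close> multiplies the third coefficient by \<open>v\<^sup>2\<close>, so it can be made real and
nonnegative.
\<close>

lemma third_coeff_bound:
  assumes f: "pointed_conformal f" shows "cmod (ncoeff f 3) \<le> 3"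
proof -
  define v where "v = cis (- Arg (ncoeff f 3) / 2)"
  have v: "v \<noteq> 0" "cmod v = 1" by (simp_all add: v_def)
  have rot: "v ^ 2 * ncoeff f 3 = of_real (cmod (ncoeff f 3))"
  proof -
    have "v ^ 2 = cis (- Arg (ncoeff f 3))" by (simp add: v_def power2_eq_square cis_mult)
    moreover have "ncoeff f 3 = of_real (cmod (ncoeff f 3)) * cis (Arg (ncoeff f 3))"
      by (metis rcis_cmod_Arg rcis_def)
    ultimately show ?thesis by (metis cis_mult cis_zero add.left_inverse mult.left_commute mult.right_neutral)
  qed
  define g where "g z = inverse v * f (v * z)" for z
  note f' = pointed_conformalD[OF f]
  have in_ball: "v * z \<in> ball 0 1" if "z \<in> ball 0 1" for z using that v by (simp add: norm_mult)
  have "f \<circ> (\<lambda>z. v * z) holomorphic_on ball 0 1"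
    using in_ball by (intro holomorphic_on_compose_gen[OF _ f'(1)]) (auto intro!: holomorphic_intros)
  then have "g holomorphic_on ball 0 1"
    unfolding g_def[abs_def] by (intro holomorphic_intros) (simp add: o_def)
  moreover have "inj_on g (ball 0 1)"
  proof (rule inj_onI)
    fix x y assume xy: "x \<in> ball 0 1" "y \<in> ball 0 1" "g x = g y"
    then have "f (v * x) = f (v * y)" using v by (simp add: g_def)
    then have "v * x = v * y" using inj_onD[OF f'(2)] in_ball xy by blast
    then show "x = y" using v by simp
  qed
  moreover have "(g has_field_derivative inverse v * (of_real (conformal_radius f) * v)) (at 0)"
    unfolding g_def by (intro DERIV_cmult DERIV_chain2[of f]) (use f'(9) in \<open>auto intro!: derivative_eq_intros\<close>)
  then have "deriv g 0 = of_real (conformal_radius f)" using v by (simp add: DERIV_imp_deriv)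
  ultimately have "pointed_conformal g"
    using f'(3,4) by (auto simp: pointed_conformal_def g_def)
  then have "Re (ncoeff g 3) \<le> 3" by (rule inverse_coeff_bounds(4))
  moreover have "ncoeff g 3 = v ^ 2 * ncoeff f 3"
    unfolding g_def using ncoeff_linear_change[OF f'(1), of "inverse v" v 3] v by simp
  ultimately show ?thesis using rot by simp
qed

section \<open>Toeplitz determinants of the inverse function\<close>

lemma class_S_pointed_conformal:
  assumes "f \<in> class_S" shows "pointed_conformal f"
  using assms by (auto simp: class_S_def class_A_def pointed_conformal_def intro!: exI[of _ 1])

lemma inverse_coeff_eq:
  assumes f: "f \<in> class_S"
  shows "inverse_coeff f 1 = 1" "inverse_coeff f 2 = inv2 f" "inverse_coeff f 3 = inv3 f" "inverse_coeff f 4 = inv4 f"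
proof -
  note f' = pointed_conformalD[OF class_S_pointed_conformal[OF f]]
  have d: "deriv f 0 = 1" using f by (simp add: class_S_def class_A_def)
  define k where "k = inv_into (ball 0 1) f"
  have kf: "k (f z) = z" if "z \<in> ball 0 1" for z using f'(2) that by (simp add: k_def)
  obtain l where l: "l holomorphic_on f ` ball 0 1" "\<And>z. cmod z < 1 \<Longrightarrow> l (f z) = z"
    using pointed_conformal_inverse[OF class_S_pointed_conformal[OF f]] by metis
  have "k holomorphic_on f ` ball 0 1"
    by (rule holomorphic_transform[OF l(1)]) (auto simp: kf l(2))
  then have K: "k has_fps_expansion fps_expansion k 0"
    by (rule has_fps_expansion_fps_expansion[OF f'(7,8)])
  define F where "F = fps_expansion f 0"
  have F: "f has_fps_expansion F" unfolding F_def
    by (rule has_fps_expansion_fps_expansion[OF _ _ f'(1)]) auto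
  have F0: "fps_nth F 0 = 0" "fps_nth F 1 = 1" using f'(3) d by (simp_all add: F_def fps_expansion_def)
  define E where "E = fps_shift 1 F"
  have E: "F = fps_X * E" by (rule fps_ext) (auto simp: E_def F0 fps_X_mult_nth)
  have "(k \<circ> f) has_fps_expansion fps_compose (fps_expansion k 0) F"
    by (rule has_fps_expansion_compose[OF K F F0(1)])
  moreover have "\<forall>\<^sub>F z in nhds 0. (k \<circ> f) z = z"
    using eventually_nhds_in_open[of "ball 0 (1::real)" "0::complex"] by (auto elim!: eventually_mono simp: kf)
  ultimately have "(\<lambda>z. z) has_fps_expansion fps_compose (fps_expansion k 0) F"
    using has_fps_expansion_cong[of "k \<circ> f" "\<lambda>z. z", OF _ refl] by blast
  then have X: "fps_compose (fps_expansion k 0) (fps_X * E) = fps_X"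
    using has_fps_expansion_fps_X fps_expansion_unique_complex unfolding E[symmetric] by blast
  have En: "fps_nth E 0 = 1" "fps_nth E 1 = ncoeff f 2" "fps_nth E 2 = ncoeff f 3" "fps_nth E 3 = ncoeff f 4"
    using F0(2) by (simp_all add: E_def ncoeff_def F_def eval_nat_numeral)
  define A where "A = fps_nth (fps_expansion k 0)"
  note low = fps_compose_X_times_low_order[of "fps_expansion k 0" E, unfolded X En, folded A_def]
  have A1: "A 1 = 1" using low(1) by simp
  have A2: "A 2 = - ncoeff f 2" using low(2) A1 by (simp add: eq_neg_iff_add_eq_0 add.commute)
  have A3: "A 3 = 2 * ncoeff f 2 ^ 2 - ncoeff f 3"
    using low(3) unfolding A1 A2 by (simp add: power2_eq_square algebra_simps)
  have A4: "A 4 = - 5 * ncoeff f 2 ^ 3 + 5 * ncoeff f 2 * ncoeff f 3 - ncoeff f 4"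
    using low(4) unfolding A1 A2 A3 by (simp add: power2_eq_square power3_eq_cube algebra_simps)
  show "inverse_coeff f 1 = 1" "inverse_coeff f 2 = inv2 f" "inverse_coeff f 3 = inv3 f" "inverse_coeff f 4 = inv4 f"
    using A1 A2 A3 A4 unfolding inverse_coeff_def k_def[symmetric] A_def inv2_def inv3_def inv4_def by simp_all
qed

text \<open>
The third identity uses \<open>2 A2\<^sup>2 - A3 = a3\<close>. It is this form of \<open>T\<^sub>3\<^sub>,\<^sub>1\<close> that gives the sharp bound:
estimating \<open>2 A2\<^sup>2 A3\<close> and \<open>A3\<^sup>2\<close> separately would not.
\<close>

lemma toeplitz_inverse:
  assumes f: "f \<in> class_S"
  shows "sym_toeplitz_det 2 2 (inverse_coeff f) = inv2 f ^ 2 - inv3 f ^ 2"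
    and "sym_toeplitz_det 2 3 (inverse_coeff f) = inv3 f ^ 2 - inv4 f ^ 2"
    and "sym_toeplitz_det 3 1 (inverse_coeff f) = 1 - 2 * inv2 f ^ 2 + inv3 f * ncoeff f 3"
proof -
  note c = inverse_coeff_eq[OF f]
  show "sym_toeplitz_det 2 2 (inverse_coeff f) = inv2 f ^ 2 - inv3 f ^ 2"
    using c by (simp add: sym_toeplitz_det_2)
  show "sym_toeplitz_det 2 3 (inverse_coeff f) = inv3 f ^ 2 - inv4 f ^ 2"
    using c by (simp add: sym_toeplitz_det_2)
  have a3: "ncoeff f 3 = 2 * inv2 f ^ 2 - inv3 f" by (simp add: inv2_def inv3_def)
  show "sym_toeplitz_det 3 1 (inverse_coeff f) = 1 - 2 * inv2 f ^ 2 + inv3 f * ncoeff f 3"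
    unfolding sym_toeplitz_det_3_1 c a3 by (simp add: power2_eq_square algebra_simps)
qed

text \<open>
The Koebe function, turned so that \<open>A2\<close> and \<open>A4\<close> are purely imaginary and \<open>A3\<close> and \<open>a3\<close> are real. Then
no cancellation takes place in any of the three determinants.
\<close>

definition rotated_koebe :: "complex \<Rightarrow> complex" where
  "rotated_koebe z = z / (1 - \<i> * z)\<^sup>2"

lemma rotated_koebe_denominator: "cmod z < 1 \<Longrightarrow> 1 - \<i> * z \<noteq> 0"
proof
  assume "cmod z < 1" "1 - \<i> * z = 0"
  then have "cmod (\<i> * z) = 1" by (metis eq_iff_diff_eq_0 norm_one)
  then show False using \<open>cmod z < 1\<close> by (simp add: norm_mult)
qed

lemma rotated_koebe_class_S: "rotated_koebe \<in> class_S"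
proof -
  have hol: "rotated_koebe holomorphic_on ball 0 1"
    unfolding rotated_koebe_def[abs_def] using rotated_koebe_denominator by (intro holomorphic_intros) auto
  have "(rotated_koebe has_field_derivative 1) (at 0)"
    unfolding rotated_koebe_def[abs_def] by (auto intro!: derivative_eq_intros)
  then have d: "deriv rotated_koebe 0 = 1" by (rule DERIV_imp_deriv)
  have "inj_on rotated_koebe (ball 0 1)"
  proof (rule inj_onI)
    fix z w :: complex assume zw: "z \<in> ball 0 1" "w \<in> ball 0 1" "rotated_koebe z = rotated_koebe w"
    then have "z * (1 - \<i> * w)\<^sup>2 = w * (1 - \<i> * z)\<^sup>2"
      using rotated_koebe_denominator[of z] rotated_koebe_denominator[of w]
      by (simp add: rotated_koebe_def frac_eq_eq)
    then have "(z - w) * (1 + z * w) = 0" by (simp add: power2_eq_square algebra_simps)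
    moreover have "1 + z * w \<noteq> 0"
    proof
      assume "1 + z * w = 0"
      then have "cmod (z * w) = 1" by (metis add_eq_0_iff norm_minus_cancel norm_one)
      moreover have "cmod (z * w) < 1" using norm_mult_less[of z 1 w 1] zw by simp
      ultimately show False by simp
    qed
    ultimately show "z = w" by simp
  qed
  then show ?thesis using hol d by (simp add: class_S_def class_A_def rotated_koebe_def)
qed

lemma rotated_koebe_inverse_coeffs:
  "inv2 rotated_koebe = - 2 * \<i>" "inv3 rotated_koebe = - 5" "inv4 rotated_koebe = 14 * \<i>"
  "ncoeff rotated_koebe 3 = - 3"
proof -
  define F where "F = fps_expansion rotated_koebe 0"
  have hol: "rotated_koebe holomorphic_on ball 0 1"
    using rotated_koebe_class_S by (simp add: class_S_def class_A_def)
  have F: "rotated_koebe has_fps_expansion F" unfolding F_def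
    by (rule has_fps_expansion_fps_expansion[OF _ _ hol]) auto
  have "(\<lambda>z. rotated_koebe z * (1 - \<i> * z)\<^sup>2) has_fps_expansion F * (1 - fps_const \<i> * fps_X)\<^sup>2"
    by (intro fps_expansion_intros F)
  moreover have "rotated_koebe z * (1 - \<i> * z)\<^sup>2 = z" if "z \<in> ball 0 1" for z
  proof -
    have "z / d * d = z" if "d \<noteq> 0" for d using that by simp
    then show ?thesis
      unfolding rotated_koebe_def using rotated_koebe_denominator[of z] that by (metis mem_ball_0 power_not_zero)
  qed
  then have "\<forall>\<^sub>F z in nhds 0. rotated_koebe z * (1 - \<i> * z)\<^sup>2 = z"
    using eventually_nhds_in_open[of "ball 0 (1::real)" "0::complex"] by (auto elim!: eventually_mono)
  ultimately have "(\<lambda>z. z) has_fps_expansion F * (1 - fps_const \<i> * fps_X)\<^sup>2"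
    using has_fps_expansion_cong[of "\<lambda>z. rotated_koebe z * (1 - \<i> * z)\<^sup>2" "\<lambda>z. z", OF _ refl] by blast
  then have "F * (1 - fps_const \<i> * fps_X)\<^sup>2 = fps_X"
    using has_fps_expansion_fps_X fps_expansion_unique_complex by blast
  moreover have "F * (1 - fps_const \<i> * fps_X)\<^sup>2
      = F - 2 * (fps_const \<i> * (fps_X * F)) - fps_X * (fps_X * F)"
  proof -
    have "F * (1 - I * fps_X)\<^sup>2 = F - 2 * (I * (fps_X * F)) + (I * I) * (fps_X * (fps_X * F))" for I
      by (simp add: power2_eq_square algebra_simps)
    moreover have "fps_const \<i> * fps_const \<i> = (- 1 :: complex fps)"
      by (simp flip: fps_const_neg)
    ultimately show ?thesis by (simp only: mult_minus1 diff_conv_add_uminus)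
  qed
  ultimately have rec: "F = fps_X + 2 * (fps_const \<i> * (fps_X * F)) + fps_X * (fps_X * F)"
    by (simp add: algebra_simps)
  have F_nth: "fps_nth F n = (if n = 1 then 1 else 0) + (if n = 0 then 0 else 2 * \<i> * fps_nth F (n - 1))
      + (if n = 0 \<or> n = 1 then 0 else fps_nth F (n - 2))" for n
    by (subst rec) (auto simp: fps_X_mult_nth numeral_fps_const numeral_2_eq_2)
  have F0: "fps_nth F 0 = 0" using F_nth[of 0] by simp
  have F1: "fps_nth F 1 = 1" using F_nth[of 1] F0 by simp
  have F2: "fps_nth F 2 = 2 * \<i>" using F_nth[of 2] F0 F1 by simp
  have F3: "fps_nth F 3 = - 3" using F_nth[of 3] F1 F2 by simp
  have F4: "fps_nth F 4 = - 4 * \<i>" using F_nth[of 4] F2 F3 by simp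
  have a: "ncoeff rotated_koebe 2 = 2 * \<i>" "ncoeff rotated_koebe 3 = - 3" "ncoeff rotated_koebe 4 = - 4 * \<i>"
    using F1 F2 F3 F4 by (simp_all add: ncoeff_def F_def)
  show "ncoeff rotated_koebe 3 = - 3" by (rule a(2))
  show "inv2 rotated_koebe = - 2 * \<i>" "inv3 rotated_koebe = - 5" "inv4 rotated_koebe = 14 * \<i>"
    by (simp_all add: inv2_def inv3_def inv4_def a power2_eq_square power3_eq_cube)
qed

theorem theorem2:
  shows "(\<forall>f\<in>class_S.
            cmod (sym_toeplitz_det 2 2 (inverse_coeff f)) \<le> 29 \<and>
            cmod (sym_toeplitz_det 2 3 (inverse_coeff f)) \<le> 221 \<and>
            cmod (sym_toeplitz_det 3 1 (inverse_coeff f)) \<le> 24) \<and>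
         (\<exists>f\<in>class_S. cmod (sym_toeplitz_det 2 2 (inverse_coeff f)) = 29) \<and>
         (\<exists>f\<in>class_S. cmod (sym_toeplitz_det 2 3 (inverse_coeff f)) = 221) \<and>
         (\<exists>f\<in>class_S. cmod (sym_toeplitz_det 3 1 (inverse_coeff f)) = 24)"
proof (intro conjI ballI)
  fix f assume f: "f \<in> class_S"
  note pc = class_S_pointed_conformal[OF f]
  note T = toeplitz_inverse[OF f]
  have sq: "cmod (w ^ 2) \<le> b ^ 2" if "cmod w \<le> b" for w b
    using that unfolding norm_power by (intro power_mono) auto
  note b = sq[OF inverse_coeff_bounds(1)[OF pc]] sq[OF inverse_coeff_bounds(2)[OF pc]] sq[OF inverse_coeff_bounds(3)[OF pc]]
  show "cmod (sym_toeplitz_det 2 2 (inverse_coeff f)) \<le> 29"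
    unfolding T(1) using norm_triangle_ineq4[of "inv2 f ^ 2" "inv3 f ^ 2"] b by simp
  show "cmod (sym_toeplitz_det 2 3 (inverse_coeff f)) \<le> 221"
    unfolding T(2) using norm_triangle_ineq4[of "inv3 f ^ 2" "inv4 f ^ 2"] b by simp
  have "cmod (inv3 f * ncoeff f 3) \<le> 5 * 3"
    unfolding norm_mult using inverse_coeff_bounds(2)[OF pc] third_coeff_bound[OF pc] by (intro mult_mono) auto
  moreover have "cmod (1 - 2 * inv2 f ^ 2) \<le> 1 + 2 * 2 ^ 2"
    using norm_triangle_ineq4[of 1 "2 * inv2 f ^ 2"] b(1) by (simp add: norm_mult)
  ultimately show "cmod (sym_toeplitz_det 3 1 (inverse_coeff f)) \<le> 24"
    unfolding T(3) using norm_triangle_ineq[of "1 - 2 * inv2 f ^ 2" "inv3 f * ncoeff f 3"] by simp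
next
  note T = toeplitz_inverse[OF rotated_koebe_class_S, unfolded rotated_koebe_inverse_coeffs]
  show "\<exists>f\<in>class_S. cmod (sym_toeplitz_det 2 2 (inverse_coeff f)) = 29"
    using rotated_koebe_class_S T(1) by (intro bexI[of _ rotated_koebe]) (simp_all add: power_mult_distrib)
  show "\<exists>f\<in>class_S. cmod (sym_toeplitz_det 2 3 (inverse_coeff f)) = 221"
    using rotated_koebe_class_S T(2) by (intro bexI[of _ rotated_koebe]) (simp_all add: power_mult_distrib)
  show "\<exists>f\<in>class_S. cmod (sym_toeplitz_det 3 1 (inverse_coeff f)) = 24"
    using rotated_koebe_class_S T(3) by (intro bexI[of _ rotated_koebe]) (simp_all add: power_mult_distrib)
qed

end
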